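(* For every $F\in C_0^\infty(\mathrm{GL}(2,\mathbb R))$ let $K_F(t,s|\mu_1,\epsilon_1;\mu_2,\epsilon_2)$ be the kernel of its Fourier transform (defined in the context), and write $D\longleftrightarrow\Theta$ if $K_{DF}=\Theta K_F$ for all $F\in C_0^\infty(\mathrm{GL}(2,\mathbb R))$. Let $a,b,c,d$ be the matrix-entry coordinates of $\begin{pmatrix}a&b\\c&d\end{pmatrix}\in\mathrm{GL}(2,\mathbb R)$. (a) The operators of multiplication by the functions $a$, $b$, $c$, $d$, $(ad-bc)^{-1}$ in $C_0^\infty(\mathrm{GL}(2,\mathbb R))$ have the following Fourier-images: $$a\ \longleftrightarrow\ V_1-\frac{t}{\mu_1-\mu_2}\Bigl(\frac{\partial}{\partial t}V_1+\frac{\partial}{\partial s}V_2\Bigr),$$ $$b\ \longleftrightarrow\ sV_1-tV_2-\frac{st}{\mu_1-\mu_2}\Bigl(\frac{\partial}{\partial t}V_1+\frac{\partial}{\partial s}V_2\Bigr),$$ $$c\ \longleftrightarrow\ \frac{1}{\mu_1-\mu_2}\Bigl(\frac{\partial}{\partial t}V_1+\frac{\partial}{\partial s}V_2\Bigr),$$ $$d\ \longleftrightarrow\ V_2+\frac{s}{\mu_1-\mu_2}\Bigl(\frac{\partial}{\partial t}V_1+\frac{\partial}{\partial s}V_2\Bigr),$$ $$(ad-bc)^{-1}\ \longleftrightarrow\ V_1^{-1}V_2^{-1}.$$ (b) The operators $\frac{\partial}{\partial a},\frac{\partial}{\partial b},\frac{\partial}{\partial c},\frac{\partial}{\partial d}$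 have the following Fourier-images: $$\frac{\partial}{\partial a}\ \longleftrightarrow\ \bigl(\tfrac32-\mu_1\bigr)V_1^{-1}+\frac{s}{\mu_1-\mu_2}\Bigl(\bigl(\tfrac32-\mu_1\bigr)\frac{\partial}{\partial s}V_1^{-1}+\bigl(\tfrac32-\mu_2\bigr)\frac{\partial}{\partial t}V_2^{-1}\Bigr),$$ $$\frac{\partial}{\partial b}\ \longleftrightarrow\ -\frac{1}{\mu_1-\mu_2}\Bigl(\bigl(\tfrac32-\mu_1\bigr)\frac{\partial}{\partial s}V_1^{-1}+\bigl(\tfrac32-\mu_2\bigr)\frac{\partial}{\partial t}V_2^{-1}\Bigr),$$ $$\frac{\partial}{\partial c}\ \longleftrightarrow\ \bigl(\tfrac32-\mu_1\bigr)tV_1^{-1}-\bigl(\tfrac32-\mu_2\bigr)sV_2^{-1}+\frac{st}{\mu_1-\mu_2}\Bigl(\bigl(\tfrac32-\mu_1\bigr)\frac{\partial}{\partial s}V_1^{-1}+\bigl(\tfrac32-\mu_2\bigr)\frac{\partial}{\partial t}V_2^{-1}\Bigr),$$ $$\frac{\partial}{\partial d}\ \longleftrightarrow\ \bigl(\tfrac32-\mu_2\bigr)V_2^{-1}-\frac{t}{\mu_1-\mu_2}\Bigl(\bigl(\tfrac32-\mu_1\bigr)\frac{\partial}{\partial s}V_1^{-1}+\bigl(\tfrac32-\mu_2\bigr)\frac{\partial}{\partial t}V_2^{-1}\Bigr).$$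
   Context: $C_0^\infty(\mathrm{GL}(2,\mathbb R))$ is the space of compactly supported smooth (complex-valued) functions on the group $\mathrm{GL}(2,\mathbb R)$ of real invertible matrices $\begin{pmatrix}a&b\\c&d\end{pmatrix}$; such a function is written $F(a,b,c,d)$ and is regarded as $0$ where $ad-bc=0$. For $\mu\in\mathbb C$, $\epsilon\in\mathbb Z_2=\mathbb Z/2\mathbb Z$ and $x\in\mathbb R\setminus\{0\}$ put $x^{\mu/\!\!/\epsilon}:=|x|^\mu\,\mathrm{sgn}(x)^\epsilon$ (in an expression such as $x^{-3/2+\mu_1/\!\!/\epsilon_1}$ the exponent of $|x|$ is $-3/2+\mu_1$ and the parity is $\epsilon_1$). Representations: for $(\mu_1,\epsilon_1,\mu_2,\epsilon_2)\in\Lambda:=\mathbb C\times\mathbb Z_2\times\mathbb C\times\mathbb Z_2$, $$T_{\mu_1,\epsilon_1;\mu_2,\epsilon_2}\begin{pmatrix}a&b\\c&d\end{pmatrix}\varphi(t)=\varphi\Bigl(\frac{b+td}{a+tc}\Bigr)(a+tc)^{-1+\mu_1-\mu_2/\!\!/\epsilon_1-\epsilon_2}\,(ad-bc)^{1/2+\mu_2/\!\!/\epsilon_2},$$ acting on smooth functions $\varphi$ on $\mathbb R$ such that $\varphi(-t^{-1})(-t)^{-1+\mu_1-\mu_2/\!\!/\epsilon_1-\epsilon_2}$ is smooth at $0$. Fourier transform: $F\in C_0^\infty(\mathrm{GL}(2,\mathbb R))$ is sent to the operator-valued function on $\Lambda$ given by $T_{\mu_1,\epsilon_1;\mu_2,\epsilon_2}(F)=\int_{\mathrm{GL}(2,\mathbb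 R)}F(g)\,T_{\mu_1,\epsilon_1;\mu_2,\epsilon_2}(g)\,dg$, where $dg=(ad-bc)^{-2}\,da\,db\,dc\,dd$ is the Haar measure. These are integral operators $T_{\mu_1,\epsilon_1;\mu_2,\epsilon_2}(F)f(t)=\int_{\mathbb R}K_F(t,s|\mu_1,\epsilon_1;\mu_2,\epsilon_2)f(s)\,ds$ with kernel $$K_F(t,s|\mu_1,\epsilon_1;\mu_2,\epsilon_2)=\iiint_{\mathbb R^3}F\bigl(u-tv,\;su-stv-tw,\;v,\;sv+w\bigr)\,u^{-3/2+\mu_1/\!\!/\epsilon_1}\,w^{-3/2+\mu_2/\!\!/\epsilon_2}\,du\,dv\,dw .$$ The kernel $K_F$ is smooth in $t,s\in\mathbb R$ and holomorphic in $\mu_1,\mu_2\in\mathbb C$. The space of all operator-valued functions obtained in this way (equivalently, of their kernels) is denoted $\mathcal E$; the Fourier-image of a differential operator $D$ on $C_0^\infty(\mathrm{GL}(2,\mathbb R))$ is the transformation $\Theta(D)$ in $\mathcal E$ with $K_{DF}=\Theta(D)K_F$ for all $F$. Shift operators: $$V_1K(t,s|\mu_1,\epsilon_1;\mu_2,\epsilon_2)=K(t,s|\mu_1+1,\epsilon_1+1;\mu_2,\epsilon_2),\qquad V_2K(t,s|\mu_1,\epsilon_1;\mu_2,\epsilon_2)=K(t,s|\mu_1,\epsilon_1;\mu_2+1,\epsilon_2+1),$$ and $V_1^{-1},V_2^{-1}$ are the inverse shifts. Compositions of operators are read right to left: the shifts are applied first, then $\partial/\partial t,\partial/\partial s$,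 then multiplication by the coefficient evaluated at the (unshifted) point $(t,s,\mu_1,\mu_2)$. Identities $K_{DF}=\Theta K_F$ involving the factor $1/(\mu_1-\mu_2)$ are identities of meromorphic functions of $(\mu_1,\mu_2)$, i.e. equalities at all points with $\mu_1\ne\mu_2$. *)

theory Defs
  imports "HOL-Analysis.Analysis" "HOL-Library.Z2"
begin

text \<open>
  Test functions are functions on the space of all real 2x2 matrices that vanish outside a
  compact subset of the (open) set of invertible matrices.
\<close>

primrec Ck_on :: "nat \<Rightarrow> 'a::real_normed_vector set \<Rightarrow> ('a \<Rightarrow> 'b::real_normed_vector) \<Rightarrow> bool"
  where
    "Ck_on 0 S f \<longleftrightarrow> continuous_on S f"
  | "Ck_on (Suc k) S f \<longleftrightarrow>
       (\<forall>x\<in>S. f differentiable (at x)) \<and> (\<forall>v. Ck_on k S (\<lambda>x. frechet_derivative f (at x) v))"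

definition smooth_on :: "'a::real_normed_vector set \<Rightarrow> ('a \<Rightarrow> 'b::real_normed_vector) \<Rightarrow> bool"
  where "smooth_on S f \<longleftrightarrow> (\<forall>k. Ck_on k S f)"

definition GL2 :: "(real^2^2) set"
  where "GL2 = {A. invertible A}"

definition test_functions :: "(real^2^2 \<Rightarrow> complex) set"
  where "test_functions =
    {F. smooth_on GL2 F \<and> compact (closure {A. F A \<noteq> 0}) \<and> closure {A. F A \<noteq> 0} \<subseteq> GL2}"

definition mat2 :: "real \<Rightarrow> real \<Rightarrow> real \<Rightarrow> real \<Rightarrow> real^2^2"
  where "mat2 a b c d = vector [vector [a, b], vector [c, d]]"

definition entry_deriv :: "2 \<Rightarrow> 2 \<Rightarrow> (real^2^2 \<Rightarrow> complex) \<Rightarrow> (real^2^2 \<Rightarrow> complex)"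
  where "entry_deriv i j F = (\<lambda>A. vector_derivative (\<lambda>h. F (A + h *\<^sub>R axis i (axis j 1))) (at 0))"

text \<open>The parity ranges over \<^typ>\<open>bit\<close>, the field with two elements.\<close>

definition signed_powr :: "real \<Rightarrow> complex \<Rightarrow> bit \<Rightarrow> complex"
  where "signed_powr x \<mu> \<epsilon> =
    complex_of_real \<bar>x\<bar> powr \<mu> * (if \<epsilon> = 0 then 1 else complex_of_real (sgn x))"

text \<open>
  The arguments of a kernel are, in this order, \<open>t\<close>, \<open>s\<close>, \<open>\<mu>\<^sub>1\<close>, \<open>\<epsilon>\<^sub>1\<close>, \<open>\<mu>\<^sub>2\<close>, \<open>\<epsilon>\<^sub>2\<close>.
\<close>

type_synonym kernel = "real \<Rightarrow> real \<Rightarrow> complex \<Rightarrow> bit \<Rightarrow> complex \<Rightarrow> bit \<Rightarrow> complex"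

text \<open>
  The kernel in \<open>(t, s)\<close> of the integral operator
  \<open>f \<mapsto> (t \<mapsto> \<integral> F(g) f((b + t d) / (a + t c)) (a + t c)\<^bsup>-1 + \<mu>\<^sub>1 - \<mu>\<^sub>2 // \<epsilon>\<^sub>1 - \<epsilon>\<^sub>2\<^esup> (a d - b c)\<^bsup>1/2 + \<mu>\<^sub>2 // \<epsilon>\<^sub>2\<^esup> dg)\<close>
  with \<open>dg = (a d - b c)\<^bsup>-2\<^esup> da db dc dd\<close>, after the substitution \<open>u = a + t c\<close>, \<open>v = c\<close>,
  \<open>s = (b + t d) / (a + t c)\<close>, \<open>w = (a d - b c) / u\<close>, whose Jacobian is \<open>\<bar>u\<bar>\<close>.
\<close>

definition fourier_kernel :: "(real^2^2 \<Rightarrow> complex) \<Rightarrow> kernel"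
  where "fourier_kernel F t s \<mu>\<^sub>1 \<epsilon>\<^sub>1 \<mu>\<^sub>2 \<epsilon>\<^sub>2 =
    (\<integral>(u, v, w). F (mat2 (u - t * v) (s * u - s * t * v - t * w) v (s * v + w))
        * signed_powr u (- 3 / 2 + \<mu>\<^sub>1) \<epsilon>\<^sub>1 * signed_powr w (- 3 / 2 + \<mu>\<^sub>2) \<epsilon>\<^sub>2
      \<partial>(lborel :: (real \<times> real \<times> real) measure))"

definition V1 :: "kernel \<Rightarrow> kernel"
  where "V1 K = (\<lambda>t s \<mu>\<^sub>1 \<epsilon>\<^sub>1 \<mu>\<^sub>2 \<epsilon>\<^sub>2. K t s (\<mu>\<^sub>1 + 1) (\<epsilon>\<^sub>1 + 1) \<mu>\<^sub>2 \<epsilon>\<^sub>2)"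

definition V2 :: "kernel \<Rightarrow> kernel"
  where "V2 K = (\<lambda>t s \<mu>\<^sub>1 \<epsilon>\<^sub>1 \<mu>\<^sub>2 \<epsilon>\<^sub>2. K t s \<mu>\<^sub>1 \<epsilon>\<^sub>1 (\<mu>\<^sub>2 + 1) (\<epsilon>\<^sub>2 + 1))"

definition V1_inv :: "kernel \<Rightarrow> kernel"
  where "V1_inv K = (\<lambda>t s \<mu>\<^sub>1 \<epsilon>\<^sub>1 \<mu>\<^sub>2 \<epsilon>\<^sub>2. K t s (\<mu>\<^sub>1 - 1) (\<epsilon>\<^sub>1 - 1) \<mu>\<^sub>2 \<epsilon>\<^sub>2)"

definition V2_inv :: "kernel \<Rightarrow> kernel"
  where "V2_inv K = (\<lambda>t s \<mu>\<^sub>1 \<epsilon>\<^sub>1 \<mu>\<^sub>2 \<epsilon>\<^sub>2. K t s \<mu>\<^sub>1 \<epsilon>\<^sub>1 (\<mu>\<^sub>2 - 1) (\<epsilon>\<^sub>2 - 1))"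

definition d_t :: "kernel \<Rightarrow> kernel"
  where "d_t K = (\<lambda>t s \<mu>\<^sub>1 \<epsilon>\<^sub>1 \<mu>\<^sub>2 \<epsilon>\<^sub>2. vector_derivative (\<lambda>x. K x s \<mu>\<^sub>1 \<epsilon>\<^sub>1 \<mu>\<^sub>2 \<epsilon>\<^sub>2) (at t))"

definition d_s :: "kernel \<Rightarrow> kernel"
  where "d_s K = (\<lambda>t s \<mu>\<^sub>1 \<epsilon>\<^sub>1 \<mu>\<^sub>2 \<epsilon>\<^sub>2. vector_derivative (\<lambda>x. K t x \<mu>\<^sub>1 \<epsilon>\<^sub>1 \<mu>\<^sub>2 \<epsilon>\<^sub>2) (at s))"

definition fourier_image ::
  "((real^2^2 \<Rightarrow> complex) \<Rightarrow> (real^2^2 \<Rightarrow> complex)) \<Rightarrow> (kernel \<Rightarrow> kernel) \<Rightarrow> bool"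
  where "fourier_image D \<Theta> \<longleftrightarrow>
    (\<forall>F\<in>test_functions. fourier_kernel (D F) = \<Theta> (fourier_kernel F))"

text \<open>
  Equality as meromorphic functions of \<open>(\<mu>\<^sub>1, \<mu>\<^sub>2)\<close> with poles on the diagonal, where
  \<open>1 / (\<mu>\<^sub>1 - \<mu>\<^sub>2)\<close> has the junk value 0.
\<close>

definition fourier_image_mero ::
  "((real^2^2 \<Rightarrow> complex) \<Rightarrow> (real^2^2 \<Rightarrow> complex)) \<Rightarrow> (kernel \<Rightarrow> kernel) \<Rightarrow> bool"
  where "fourier_image_mero D \<Theta> \<longleftrightarrow>
    (\<forall>F\<in>test_functions. \<forall>t s \<mu>\<^sub>1 \<epsilon>\<^sub>1 \<mu>\<^sub>2 \<epsilon>\<^sub>2. \<mu>\<^sub>1 \<noteq> \<mu>\<^sub>2 \<longrightarrow>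
      fourier_kernel (D F) t s \<mu>\<^sub>1 \<epsilon>\<^sub>1 \<mu>\<^sub>2 \<epsilon>\<^sub>2 = \<Theta> (fourier_kernel F) t s \<mu>\<^sub>1 \<epsilon>\<^sub>1 \<mu>\<^sub>2 \<epsilon>\<^sub>2)"

end

theory Submission
  imports Defs
begin

text \<open>
  Write \<open>K[F]\<close> for the kernel of \<open>F\<close>, suppress the arguments that are not shifted, and let
  \<open>F\<^sub>b\<close> be the derivative of \<open>F\<close> in the upper right entry. For given \<open>t\<close> and \<open>s\<close> the triples
  \<open>(u, v, w)\<close> parametrize the hyperplane \<open>b + t d = s (a + t c)\<close> of matrices; the determinant is \<open>u w\<close>
  there, and \<open>K[F]\<close> is the integral of \<open>F\<close> against the signed powers
  \<open>u\<^bsup>-3/2 + \<mu>\<^sub>1\<^esup> w\<^bsup>-3/2 + \<mu>\<^sub>2\<^esup>\<close>. These are singular only where \<open>u w = 0\<close>, and there \<open>F\<close> vanishes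
  locally, so the integrands are continuous with compact support.

  Two principles are used. Since Lebesgue measure is translation invariant, the integral of a
  directional derivative vanishes; in the chart this says that differentiating \<open>F\<close> along \<open>u\<close> or
  \<open>w\<close> multiplies the kernel by \<open>3/2 - \<mu>\<^sub>1\<close> or \<open>3/2 - \<mu>\<^sub>2\<close> and lowers that parameter by \<open>1\<close>, while
  differentiating along \<open>v\<close> gives \<open>0\<close> (lemma \<open>fourier_kernel_directional_derivative\<close>). And
  \<open>t\<close> and \<open>s\<close> may be differentiated under the integral. At fixed \<open>(u, v, w)\<close> the matrix moves with \<open>t\<close> in
  the direction \<open>- v \<partial>\<^sub>u - w E\<^sub>b\<close> and with \<open>s\<close> in the direction \<open>v \<partial>\<^sub>w + u E\<^sub>b\<close>, where \<open>E\<^sub>b\<close> is the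
  matrix unit of the entry \<open>b\<close>. Because \<open>v\<close> is the entry \<open>c\<close>, which is constant along \<open>u\<close> and
  \<open>w\<close>, the first principle applies to the function \<open>c F\<close> and yields
  \<open>\<partial>\<^sub>t K[F] = - (3/2 - \<mu>\<^sub>1) K[c F](\<mu>\<^sub>1 - 1) - K[F\<^sub>b](\<mu>\<^sub>2 + 1)\<close> and
  \<open>\<partial>\<^sub>s K[F] = (3/2 - \<mu>\<^sub>2) K[c F](\<mu>\<^sub>2 - 1) + K[F\<^sub>b](\<mu>\<^sub>1 + 1)\<close>
  (lemmas \<open>fourier_kernel_has_vector_derivative_t\<close> and \<open>fourier_kernel_has_vector_derivative_s\<close>).

  These two equations can be solved for their two unknowns. In \<open>\<partial>\<^sub>t V\<^sub>1 + \<partial>\<^sub>s V\<^sub>2\<close> the terms with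
  \<open>F\<^sub>b\<close> cancel and \<open>(\<mu>\<^sub>1 - \<mu>\<^sub>2) K[c F]\<close> remains; in
  \<open>(3/2 - \<mu>\<^sub>1) \<partial>\<^sub>s V\<^sub>1\<^sup>-\<^sup>1 + (3/2 - \<mu>\<^sub>2) \<partial>\<^sub>t V\<^sub>2\<^sup>-\<^sup>1\<close> the terms with \<open>c F\<close> cancel and
  \<open>- (\<mu>\<^sub>1 - \<mu>\<^sub>2) K[F\<^sub>b]\<close> remains. The other entries are combinations of \<open>u\<close>, \<open>w\<close> and \<open>c\<close>, the
  other coordinate derivatives are combinations of the three chart directions and \<open>E\<^sub>b\<close>, and
  \<open>1 / (u w)\<close> lowers both exponents.
\<close>

section \<open>Compactly supported functions on the group\<close>

definition Cc_GL2 :: "(real^2^2 \<Rightarrow> complex) set"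
  where "Cc_GL2 = {F. continuous_on UNIV F \<and> compact (closure {A. F A \<noteq> 0})
    \<and> closure {A. F A \<noteq> 0} \<subseteq> GL2}"

text \<open>
  The derivative is carried along as a second argument so that products with matrix entries come
  with an explicit derivative. Only first derivatives of \<open>F\<close> enter the formulas, and this class is
  closed under multiplication by matrix entries.
\<close>

definition C1c_GL2 :: "(real^2^2 \<Rightarrow> complex) \<Rightarrow> (real^2^2 \<Rightarrow> real^2^2 \<Rightarrow> complex) \<Rightarrow> bool"
  where "C1c_GL2 F F' \<longleftrightarrow> F \<in> Cc_GL2 \<and> (\<forall>A. (F has_derivative F' A) (at A))
    \<and> (\<forall>X. (\<lambda>A. F' A X) \<in> Cc_GL2)"

section \<open>Matrix coordinates\<close>

text \<open>
  At fixed \<open>t\<close> and \<open>s\<close> the chart is linear, so that it also maps directions in \<open>(u, v, w)\<close> to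
  directions in the space of matrices.
\<close>

definition chart :: "real \<Rightarrow> real \<Rightarrow> real \<times> real \<times> real \<Rightarrow> real^2^2"
  where "chart t s = (\<lambda>(u, v, w). mat2 (u - t * v) (s * u - s * t * v - t * w) v (s * v + w))"

definition weight :: "complex \<Rightarrow> bit \<Rightarrow> complex \<Rightarrow> bit \<Rightarrow> real \<times> real \<times> real \<Rightarrow> complex"
  where "weight \<mu>\<^sub>1 \<epsilon>\<^sub>1 \<mu>\<^sub>2 \<epsilon>\<^sub>2 = (\<lambda>(u, v, w).
    signed_powr u (- 3 / 2 + \<mu>\<^sub>1) \<epsilon>\<^sub>1 * signed_powr w (- 3 / 2 + \<mu>\<^sub>2) \<epsilon>\<^sub>2)"

lemma fourier_kernel_eq:
  "fourier_kernel F t s \<mu>\<^sub>1 \<epsilon>\<^sub>1 \<mu>\<^sub>2 \<epsilon>\<^sub>2 =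
    (\<integral>p. F (chart t s p) * weight \<mu>\<^sub>1 \<epsilon>\<^sub>1 \<mu>\<^sub>2 \<epsilon>\<^sub>2 p \<partial>lborel)"
  by (simp add: fourier_kernel_def chart_def weight_def case_prod_unfold mult.assoc)

lemma mat2_nth [simp]:
  "mat2 a b c d $ 1 $ 1 = a" "mat2 a b c d $ 1 $ 2 = b"
  "mat2 a b c d $ 2 $ 1 = c" "mat2 a b c d $ 2 $ 2 = d"
  by (simp_all add: mat2_def)

lemma mat2_eqI:
  fixes A B :: "real^2^2"
  assumes "A $ 1 $ 1 = B $ 1 $ 1" "A $ 1 $ 2 = B $ 1 $ 2" "A $ 2 $ 1 = B $ 2 $ 1" "A $ 2 $ 2 = B $ 2 $ 2"
  shows "A = B"
  using assms by (simp add: vec_eq_iff forall_2)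

lemma det_chart: "det (chart t s p) = fst p * snd (snd p)"
  by (simp add: chart_def case_prod_unfold det_2 algebra_simps)

text \<open>
  Continuity of matrix-valued maps is reduced to continuity of their entries by this expansion.
\<close>

lemma mat2_linear_combination:
  "mat2 a b c d = a *\<^sub>R mat2 1 0 0 0 + b *\<^sub>R mat2 0 1 0 0 + c *\<^sub>R mat2 0 0 1 0 + d *\<^sub>R mat2 0 0 0 1"
  by (rule mat2_eqI) simp_all

lemma axis_mat2:
  "axis 1 (axis 1 1) = mat2 1 0 0 0" "axis 1 (axis 2 1) = mat2 0 1 0 0"
  "axis 2 (axis 1 1) = mat2 0 0 1 0" "axis 2 (axis 2 1) = mat2 0 0 0 1"
  by (rule mat2_eqI; simp add: axis_def)+

lemma continuous_on_chart [continuous_intros]: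
  assumes "continuous_on S t" "continuous_on S s" "continuous_on S p"
  shows "continuous_on S (\<lambda>x. chart (t x) (s x) (p x))"
  unfolding chart_def case_prod_unfold mat2_linear_combination[of "_ - _"]
  by (intro continuous_intros assms)

lemma chart_add_scaleR: "chart t s (p + x *\<^sub>R e) = chart t s p + x *\<^sub>R chart t s e"
  by (rule mat2_eqI) (simp_all add: chart_def case_prod_unfold algebra_simps)

lemma mem_GL2: "A \<in> GL2 \<longleftrightarrow> det A \<noteq> 0"
  by (simp add: GL2_def invertible_det_nz)

lemma open_GL2: "open GL2"
proof -
  have "GL2 = {A::real^2^2. A $ 1 $ 1 * A $ 2 $ 2 - A $ 1 $ 2 * A $ 2 $ 1 \<noteq> 0}"
    by (auto simp: mem_GL2 det_2)
  also have "open \<dots>"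
    by (intro open_Collect_neq continuous_intros)
  finally show ?thesis .
qed

lemma Cc_GL2_zero:
  assumes "F \<in> Cc_GL2" "det A = 0"
  shows "F A = 0"
  using assms closure_subset[of "{A. F A \<noteq> 0}"] by (fastforce simp: Cc_GL2_def mem_GL2)

section \<open>Closure properties of the function spaces\<close>

lemma compact_closure_subset:
  assumes "compact (closure S)" "closure T \<subseteq> closure S"
  shows "compact (closure T)"
  using compact_Int_closed[OF assms(1) closed_closure[of T]] assms(2) by (simp add: Int_absorb1)

lemma Cc_GL2_mono:
  assumes "F \<in> Cc_GL2" "continuous_on UNIV G" "\<And>A. A \<notin> closure {A. F A \<noteq> 0} \<Longrightarrow> G A = 0"
  shows "G \<in> Cc_GL2"
proof -
  have "closure {A. G A \<noteq> 0} \<subseteq> closure {A. F A \<noteq> 0}"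
    using assms(3) by (intro closure_minimal) auto
  moreover have "compact (closure {A. G A \<noteq> 0})"
    by (rule compact_closure_subset[OF _ calculation]) (use assms(1) in \<open>simp add: Cc_GL2_def\<close>)
  ultimately show ?thesis
    using assms by (auto simp: Cc_GL2_def)
qed

lemma Cc_GL2_mult:
  assumes "F \<in> Cc_GL2" "continuous_on UNIV f"
  shows "(\<lambda>A. f A * F A) \<in> Cc_GL2"
proof (rule Cc_GL2_mono[OF assms(1)])
  show "continuous_on UNIV (\<lambda>A. f A * F A)"
    using assms by (auto simp: Cc_GL2_def intro!: continuous_intros)
  show "f A * F A = 0" if "A \<notin> closure {A. F A \<noteq> 0}" for A
    using that closure_subset[of "{A. F A \<noteq> 0}"] by auto
qed

lemma Cc_GL2_add:
  assumes "F \<in> Cc_GL2" "G \<in> Cc_GL2"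
  shows "(\<lambda>A. F A + G A) \<in> Cc_GL2"
proof -
  have *: "{A. F A + G A \<noteq> 0} \<subseteq> {A. F A \<noteq> 0} \<union> {A. G A \<noteq> 0}"
    by auto
  have sub: "closure {A. F A + G A \<noteq> 0} \<subseteq> closure {A. F A \<noteq> 0} \<union> closure {A. G A \<noteq> 0}"
    using closure_mono[OF *] by simp
  have "compact (closure ({A. F A \<noteq> 0} \<union> {A. G A \<noteq> 0}))"
    unfolding closure_Un using assms by (intro compact_Un) (auto simp: Cc_GL2_def)
  then have "compact (closure {A. F A + G A \<noteq> 0})"
    by (rule compact_closure_subset) (use sub in simp)
  with sub assms show ?thesis
    by (auto simp: Cc_GL2_def intro!: continuous_intros)
qed

section \<open>Signed powers\<close>

lemma continuous_on_signed_powr: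
  "continuous_on (- {0}) (\<lambda>x. signed_powr x \<mu> \<epsilon>)"
proof -
  have 1: "continuous_on (- {0::real}) (\<lambda>x. complex_of_real \<bar>x\<bar> powr \<mu>)"
    by (intro continuous_intros) auto
  have 2: "continuous_on (- {0::real}) (\<lambda>x. complex_of_real (sgn x))"
    by (intro continuous_intros) auto
  show ?thesis
    unfolding signed_powr_def using 1 2 by (cases "\<epsilon> = 0") (auto intro!: continuous_intros)
qed

text \<open>
  Differentiation switches the parity because \<open>\<bar>x\<bar>\<close> has derivative \<open>sgn x\<close>. With \<open>\<sigma> = sgn x\<close> both signs
  of \<open>x\<close> are treated at once: near \<open>x\<close> the function is a constant times the power of \<open>\<sigma> y > 0\<close>.
\<close>

lemma has_vector_derivative_signed_powr:
  assumes "x \<noteq> 0"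
  shows "((\<lambda>x. signed_powr x \<mu> \<epsilon>) has_vector_derivative \<mu> * signed_powr x (\<mu> - 1) (\<epsilon> - 1)) (at x)"
proof -
  define \<sigma> where "\<sigma> = sgn x"
  have \<sigma>: "\<sigma> * x > 0" "\<sigma> * \<sigma> = 1" "sgn x = \<sigma>" "\<bar>x\<bar> = \<sigma> * x"
    using assms by (auto simp: \<sigma>_def sgn_if)
  have *: "signed_powr y m e = complex_of_real (\<sigma> * y) powr m * (if e = 0 then 1 else of_real \<sigma>)"
    if "y \<in> {y. \<sigma> * y > 0}" for y m e
  proof -
    have "\<bar>y\<bar> = \<sigma> * y" "sgn y = \<sigma>"
      using that assms by (auto simp: \<sigma>_def sgn_if zero_less_mult_iff split: if_splits)
    then show ?thesis by (simp add: signed_powr_def)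
  qed
  have op: "open {y. \<sigma> * y > 0}"
    by (intro open_Collect_less continuous_intros)
  have inner: "((\<lambda>y. complex_of_real (\<sigma> * y)) has_vector_derivative of_real \<sigma>) (at x)"
    by (auto intro!: derivative_eq_intros has_vector_derivative_of_real simp: has_real_derivative_iff_has_vector_derivative[symmetric])
  have outer: "((\<lambda>z. z powr \<mu>) has_field_derivative \<mu> * of_real (\<sigma> * x) powr (\<mu> - 1)) (at (complex_of_real (\<sigma> * x)))"
    using \<sigma> by (intro has_field_derivative_powr) (simp add: complex_nonpos_Reals_iff)
  have d: "((\<lambda>y. complex_of_real (\<sigma> * y) powr \<mu>) has_vector_derivative
      of_real \<sigma> * (\<mu> * of_real (\<sigma> * x) powr (\<mu> - 1))) (at x)"
    using field_vector_diff_chain_at[OF inner outer] by (simp add: o_def)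
  have d2: "((\<lambda>y. complex_of_real (\<sigma> * y) powr \<mu> * (if \<epsilon> = 0 then 1 else of_real \<sigma>)) has_vector_derivative
      of_real \<sigma> * (\<mu> * of_real (\<sigma> * x) powr (\<mu> - 1)) * (if \<epsilon> = 0 then 1 else of_real \<sigma>)) (at x)"
    by (rule has_vector_derivative_mult_left[OF d])
  have "complex_of_real \<sigma> * of_real \<sigma> = 1"
    using \<sigma>(2) by (metis of_real_1 of_real_mult)
  then have val: "of_real \<sigma> * (\<mu> * of_real (\<sigma> * x) powr (\<mu> - 1)) * (if \<epsilon> = 0 then 1 else of_real \<sigma>)
      = \<mu> * signed_powr x (\<mu> - 1) (\<epsilon> - 1)"
    using \<sigma>(1) by (cases \<epsilon>) (auto simp: * algebra_simps)
  show ?thesis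
    by (rule has_vector_derivative_transform_within_open[OF d2[unfolded val] op])
       (use \<sigma> in \<open>auto simp: *\<close>)
qed

lemma signed_powr_add_1:
  "signed_powr x (\<mu> + 1) (\<epsilon> + 1) = of_real x * signed_powr x \<mu> \<epsilon>"
proof (cases "x = 0")
  case False
  have "complex_of_real \<bar>x\<bar> * of_real (sgn x) = of_real x"
    by (metis abs_mult_sgn of_real_mult)
  moreover have "complex_of_real \<bar>x\<bar> = of_real x * of_real (sgn x)"
    by (metis abs_sgn of_real_mult)
  ultimately show ?thesis
    using False by (cases \<epsilon>) (auto simp: signed_powr_def powr_add)
qed (simp add: signed_powr_def)

section \<open>Integrals of continuous functions with bounded support\<close>

lemma integrable_continuous_bounded_support:
  fixes f :: "'a::euclidean_space \<Rightarrow> 'b::{banach, second_countable_topology}"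
  assumes "continuous_on UNIV f" "bounded {x. f x \<noteq> 0}"
  shows "integrable lborel f"
proof -
  have "integrable lborel (\<lambda>x. indicator (closure {x. f x \<noteq> 0}) x *\<^sub>R f x)"
    using assms by (intro borel_integrable_compact) (auto intro: continuous_on_subset)
  also have "(\<lambda>x. indicator (closure {x. f x \<noteq> 0}) x *\<^sub>R f x) = f"
    using closure_subset[of "{x. f x \<noteq> 0}"] by (intro ext) (auto simp: indicator_def)
  finally show ?thesis .
qed

lemma integral_lborel_eq_integral_cbox:
  fixes f :: "'a::euclidean_space \<Rightarrow> 'b::euclidean_space"
  assumes "continuous_on UNIV f" "{x. f x \<noteq> 0} \<subseteq> cbox a b"
  shows "(\<integral>x. f x \<partial>lborel) = integral (cbox a b) f"
proof -
  have "integrable lborel f"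
    using assms by (intro integrable_continuous_bounded_support) (auto intro: bounded_subset[OF bounded_cbox])
  then have "(\<integral>x. f x \<partial>lborel) = integral UNIV f"
    by (rule integral_lborel[symmetric])
  moreover have "f = (\<lambda>x. if x \<in> cbox a b then f x else 0)"
    using assms(2) by (intro ext) auto
  ultimately show ?thesis
    using Henstock_Kurzweil_Integration.integral_restrict_UNIV[of "cbox a b" f] by simp
qed

text \<open>
  The Leibniz rule on a box becomes a statement about the whole space once a single box contains the
  supports of all integrands with parameter near \<open>x0\<close>; the derivatives of the integrands then vanish
  outside of it as well.
\<close>

lemma has_vector_derivative_integral_lborel:
  fixes f f' :: "real \<Rightarrow> 'a::euclidean_space \<Rightarrow> 'b::euclidean_space"
  assumes der: "\<And>x p. ((\<lambda>x. f x p) has_vector_derivative f' x p) (at x)"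
    and cont: "\<And>x. continuous_on UNIV (f x)"
    and cont': "continuous_on UNIV (\<lambda>(x, p). f' x p)"
    and supp: "bounded (\<Union>x\<in>cball x0 1. {p. f x p \<noteq> 0})"
  shows "((\<lambda>x. \<integral>p. f x p \<partial>lborel) has_vector_derivative (\<integral>p. f' x0 p \<partial>lborel)) (at x0)"
proof -
  obtain a where a: "(\<Union>x\<in>cball x0 1. {p. f x p \<noteq> 0}) \<subseteq> cbox (- a) a"
    using bounded_subset_cbox_symmetric[OF supp] by blast
  have sub: "{p. f x p \<noteq> 0} \<subseteq> cbox (- a) a" if "x \<in> ball x0 1" for x
    using a that by fastforce
  have sub': "{p. f' x0 p \<noteq> 0} \<subseteq> cbox (- a) a"
  proof clarify
    fix p assume p: "f' x0 p \<noteq> 0"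
    show "p \<in> cbox (- a) a"
    proof (rule ccontr)
      assume "p \<notin> cbox (- a) a"
      then have "f x p = 0" if "x \<in> ball x0 1" for x
        using sub[OF that] by auto
      then have "((\<lambda>x. f x p) has_vector_derivative 0) (at x0)"
        by (intro has_vector_derivative_transform_within_open[OF has_vector_derivative_const, of "ball x0 1" _ 0])
           auto
      with der[where x = x0 and p = p] p show False
        using vector_derivative_unique_at by blast
    qed
  qed
  have "continuous_on UNIV (\<lambda>p. case (x0, p) of (x, p) \<Rightarrow> f' x p)"
    by (rule continuous_on_compose2[OF cont']) (auto intro!: continuous_intros)
  then have cont'0: "continuous_on UNIV (f' x0)"
    by simp
  have "((\<lambda>x. integral (cbox (- a) a) (f x)) has_vector_derivative integral (cbox (- a) a) (f' x0))
      (at x0 within UNIV)"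
  proof (rule leibniz_rule_vector_derivative)
    show "f x integrable_on cbox (- a) a" for x
      using cont by (intro integrable_continuous) (auto intro: continuous_on_subset)
    show "continuous_on (UNIV \<times> cbox (- a) a) (\<lambda>(x, p). f' x p)"
      using cont' by (rule continuous_on_subset) auto
  qed (use der in auto)
  then have "((\<lambda>x. \<integral>p. f x p \<partial>lborel) has_vector_derivative integral (cbox (- a) a) (f' x0)) (at x0)"
    by (rule has_vector_derivative_transform_within_open[of _ _ _ "ball x0 1"])
       (use integral_lborel_eq_integral_cbox[OF cont sub] in auto)
  then show ?thesis
    by (simp add: integral_lborel_eq_integral_cbox[OF cont'0 sub'])
qed

text \<open>
  Integration by parts in disguise: the integral of the translate of \<open>h\<close> by \<open>x *\<^sub>R e\<close> does not
  depend on \<open>x\<close>, and its derivative at \<open>0\<close> is the integral of \<open>h'\<close>.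
\<close>

lemma integral_directional_derivative_eq_0:
  fixes h h' :: "'a::euclidean_space \<Rightarrow> 'b::euclidean_space"
  assumes der: "\<And>p. ((\<lambda>x. h (p + x *\<^sub>R e)) has_vector_derivative h' p) (at 0)"
    and cont: "continuous_on UNIV h" "continuous_on UNIV h'"
    and supp: "bounded {p. h p \<noteq> 0}"
  shows "(\<integral>p. h' p \<partial>lborel) = 0"
proof -
  have "((\<lambda>x. \<integral>p. h (p + x *\<^sub>R e) \<partial>lborel) has_vector_derivative (\<integral>p. h' (p + 0 *\<^sub>R e) \<partial>lborel)) (at 0)"
  proof (rule has_vector_derivative_integral_lborel)
    fix x p
    have "((\<lambda>y. h ((p + x *\<^sub>R e) + (y - x) *\<^sub>R e)) has_vector_derivative h' (p + x *\<^sub>R e)) (at x)"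
      using vector_diff_chain_at[of "\<lambda>y. y - x" 1 x "\<lambda>x'. h ((p + x *\<^sub>R e) + x' *\<^sub>R e)" "h' (p + x *\<^sub>R e)"]
        der[of "p + x *\<^sub>R e"]
      by (simp add: o_def has_vector_derivative_diff_const)
    then show "((\<lambda>y. h (p + y *\<^sub>R e)) has_vector_derivative h' (p + x *\<^sub>R e)) (at x)"
      by (simp add: algebra_simps)
  next
    show "continuous_on UNIV (\<lambda>p. h (p + x *\<^sub>R e))" for x
      by (intro continuous_on_compose2[OF cont(1)] continuous_intros) auto
    show "continuous_on UNIV (\<lambda>(x, p). h' (p + x *\<^sub>R e))"
      unfolding case_prod_unfold
      by (intro continuous_on_compose2[OF cont(2)] continuous_intros) auto
    have "(\<Union>x\<in>cball 0 1. {p. h (p + x *\<^sub>R e) \<noteq> 0}) \<subseteq>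
        (\<lambda>(x, q). q - x *\<^sub>R e) ` (cball 0 1 \<times> closure {p. h p \<noteq> 0})"
    proof clarify
      fix x :: real and p assume x: "x \<in> cball 0 1" "h (p + x *\<^sub>R e) \<noteq> 0"
      then have "p + x *\<^sub>R e \<in> closure {p. h p \<noteq> 0}"
        using closure_subset[of "{p. h p \<noteq> 0}"] by auto
      with x show "p \<in> (\<lambda>(x, q). q - x *\<^sub>R e) ` (cball 0 1 \<times> closure {p. h p \<noteq> 0})"
        by (intro image_eqI[of _ _ "(x, p + x *\<^sub>R e)"]) auto
    qed
    moreover have "compact ((\<lambda>(x, q). q - x *\<^sub>R e) ` (cball 0 1 \<times> closure {p. h p \<noteq> 0}))"
      using supp unfolding case_prod_unfold
      by (intro compact_continuous_image compact_Times continuous_intros) auto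
    ultimately show "bounded (\<Union>x\<in>cball 0 1. {p. h (p + x *\<^sub>R e) \<noteq> 0})"
      by (intro bounded_subset[OF compact_imp_bounded])
  qed
  moreover have "(\<integral>p. h (p + x *\<^sub>R e) \<partial>lborel) = (\<integral>p. h p \<partial>lborel)" for x
  proof -
    have "(\<integral>p. h p \<partial>distr lborel borel ((+) (x *\<^sub>R e))) = (\<integral>p. h (x *\<^sub>R e + p) \<partial>lborel)"
      by (rule integral_distr) (use cont(1) in \<open>auto intro: borel_measurable_continuous_onI\<close>)
    then show ?thesis
      by (simp add: lborel_distr_plus add.commute)
  qed
  ultimately have "((\<lambda>x::real. \<integral>p. h p \<partial>lborel) has_vector_derivative (\<integral>p. h' p \<partial>lborel)) (at 0)"
    by simp
  then show ?thesis
    using vector_derivative_unique_at[OF _ has_vector_derivative_const] by blast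
qed

section \<open>The integrand of the kernel\<close>

text \<open>
  The weight is discontinuous where \<open>u w = 0\<close>. There the determinant of the chart vanishes, so a
  whole neighbourhood is mapped outside the support of \<open>F\<close>. The map \<open>p\<close> may depend on further
  parameters, which gives joint continuity in \<open>t\<close> or \<open>s\<close> and the point of the chart.
\<close>

lemma continuous_on_pullback:
  assumes F: "F \<in> Cc_GL2"
    and cont: "continuous_on UNIV t" "continuous_on UNIV s" "continuous_on UNIV p"
  shows "continuous_on UNIV (\<lambda>x. F (chart (t x) (s x) (p x)) * weight \<mu>\<^sub>1 \<epsilon>\<^sub>1 \<mu>\<^sub>2 \<epsilon>\<^sub>2 (p x))"
    (is "continuous_on UNIV ?G")
proof -
  define S where "S = closure {A. F A \<noteq> 0}"
  define U where "U = {x. fst (p x) \<noteq> 0} \<inter> {x. snd (snd (p x)) \<noteq> 0}"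
  define W where "W = (\<lambda>x. chart (t x) (s x) (p x)) -` (- S)"
  have M: "continuous_on UNIV (\<lambda>x. chart (t x) (s x) (p x))"
    by (intro continuous_intros cont)
  have oU: "open U"
    unfolding U_def by (intro open_Int open_Collect_neq continuous_intros cont)
  have oW: "open W"
    unfolding W_def by (intro open_vimage M) (simp add: S_def open_Compl)
  have cF: "continuous_on UNIV F"
    using F by (simp add: Cc_GL2_def)
  have "continuous_on U ?G"
    unfolding weight_def case_prod_unfold
  proof (intro continuous_intros)
    show "continuous_on U (\<lambda>x. F (chart (t x) (s x) (p x)))"
      by (rule continuous_on_compose2[OF cF continuous_on_subset[OF M]]) auto
    show "continuous_on U (\<lambda>x. signed_powr (fst (p x)) (- 3 / 2 + \<mu>\<^sub>1) \<epsilon>\<^sub>1)"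
      by (rule continuous_on_compose2[OF continuous_on_signed_powr])
         (auto simp: U_def intro!: continuous_intros continuous_on_subset[OF cont(3)])
    show "continuous_on U (\<lambda>x. signed_powr (snd (snd (p x))) (- 3 / 2 + \<mu>\<^sub>2) \<epsilon>\<^sub>2)"
      by (rule continuous_on_compose2[OF continuous_on_signed_powr])
         (auto simp: U_def intro!: continuous_intros continuous_on_subset[OF cont(3)])
  qed
  moreover have "?G x = 0" if "x \<in> W" for x
    using that closure_subset[of "{A. F A \<noteq> 0}"] by (auto simp: W_def S_def)
  then have "continuous_on W ?G"
    by (intro continuous_on_eq[OF continuous_on_const[of W 0]]) metis
  ultimately have "continuous_on (U \<union> W) ?G"
    using oU oW by (intro continuous_on_open_Un)
  moreover have "U \<union> W = UNIV"
  proof -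
    have "x \<in> W" if "x \<notin> U" for x
    proof -
      have "det (chart (t x) (s x) (p x)) = 0"
        using that by (auto simp: det_chart U_def)
      then show ?thesis
        using F by (auto simp: W_def S_def Cc_GL2_def mem_GL2)
    qed
    then show ?thesis by blast
  qed
  ultimately show ?thesis by simp
qed

text \<open>
  The chart is inverted by \<open>u = a + t c\<close>, \<open>v = c\<close>, \<open>w = d - s c\<close>, and this is continuous in \<open>t\<close>,
  \<open>s\<close> and the matrix, so it maps compact sets to compact sets.
\<close>

lemma bounded_chart_support:
  assumes F: "F \<in> Cc_GL2" and "compact T" "compact S"
  shows "bounded (\<Union>t\<in>T. \<Union>s\<in>S. {p. F (chart t s p) \<noteq> 0})"
proof -
  define j :: "real \<times> real \<times> (real^2^2) \<Rightarrow> real \<times> real \<times> real"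
    where "j = (\<lambda>(t, s, A). (A $ 1 $ 1 + t * A $ 2 $ 1, A $ 2 $ 1, A $ 2 $ 2 - s * A $ 2 $ 1))"
  have inv: "j (t, s, chart t s p) = p" for t s p
    by (simp add: j_def chart_def case_prod_unfold)
  let ?C = "j ` (T \<times> S \<times> closure {A. F A \<noteq> 0})"
  have "p \<in> ?C" if "t \<in> T" "s \<in> S" "F (chart t s p) \<noteq> 0" for t s p
  proof (rule image_eqI)
    show "p = j (t, s, chart t s p)" by (simp add: inv)
    show "(t, s, chart t s p) \<in> T \<times> S \<times> closure {A. F A \<noteq> 0}"
      using that closure_subset[of "{A. F A \<noteq> 0}"] by auto
  qed
  then have "(\<Union>t\<in>T. \<Union>s\<in>S. {p. F (chart t s p) \<noteq> 0}) \<subseteq> ?C"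
    by blast
  moreover have "compact ?C"
    using assms unfolding j_def case_prod_unfold
    by (intro compact_continuous_image compact_Times continuous_intros) (auto simp: Cc_GL2_def)
  ultimately show ?thesis
    by (intro bounded_subset[OF compact_imp_bounded])
qed

section \<open>Differentiable functions on the group\<close>

lemma has_vector_derivative_along_line:
  assumes "\<And>A. (F has_derivative F' A) (at A)"
  shows "((\<lambda>x. F (B + x *\<^sub>R X)) has_vector_derivative F' (B + x *\<^sub>R X) X) (at x)"
proof -
  have "((\<lambda>x. B + x *\<^sub>R X) has_vector_derivative X) (at x)"
    by (auto intro!: derivative_eq_intros)
  then have "((F \<circ> (\<lambda>x. B + x *\<^sub>R X)) has_vector_derivative F' (B + x *\<^sub>R X) X) (at x)"
    by (rule vector_derivative_diff_chain_within) (rule has_derivative_at_withinI[OF assms])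
  then show ?thesis by (simp add: o_def)
qed

lemma C1c_GL2_dest:
  assumes "C1c_GL2 F F'"
  shows "F \<in> Cc_GL2" "(F has_derivative F' A) (at A)" "(\<lambda>A. F' A X) \<in> Cc_GL2" "linear (F' A)"
  using assms by (auto simp: C1c_GL2_def intro: has_derivative_linear)

lemma continuous_on_entry: "continuous_on S (\<lambda>A::real^2^2. complex_of_real (A $ i $ j))"
  by (intro continuous_intros)

lemma C1c_GL2_mult_entry:
  assumes F: "C1c_GL2 F F'"
  shows "C1c_GL2 (\<lambda>A. of_real (A $ i $ j) * F A)
    (\<lambda>A X. of_real (A $ i $ j) * F' A X + of_real (X $ i $ j) * F A)"
  unfolding C1c_GL2_def
proof (intro conjI allI)
  note F = C1c_GL2_dest[OF F]
  show "(\<lambda>A. of_real (A $ i $ j) * F A) \<in> Cc_GL2"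
    by (intro Cc_GL2_mult F continuous_on_entry)
  show "(\<lambda>A. of_real (A $ i $ j) * F' A X + of_real (X $ i $ j) * F A) \<in> Cc_GL2" for X
    by (intro Cc_GL2_add Cc_GL2_mult F continuous_on_entry continuous_intros)
  show "((\<lambda>A. of_real (A $ i $ j) * F A) has_derivative
      (\<lambda>X. of_real (A $ i $ j) * F' A X + of_real (X $ i $ j) * F A)) (at A)" for A
  proof (rule has_derivative_mult)
    have "bounded_linear (\<lambda>A::real^2^2. complex_of_real (A $ i $ j))"
      by (intro bounded_linear_compose[OF bounded_linear_of_real]
          bounded_linear_compose[OF bounded_linear_vec_nth bounded_linear_vec_nth])
    then show "((\<lambda>A::real^2^2. complex_of_real (A $ i $ j)) has_derivative (\<lambda>X. of_real (X $ i $ j))) (at A)"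
      by (rule bounded_linear_imp_has_derivative)
  qed (rule F)
qed

text \<open>
  Smoothness is only required on the group; outside the support, which is compact in the group,
  the function is locally \<open>0\<close>, so it is differentiable on the whole matrix space.
\<close>

lemma test_functions_C1c:
  assumes "F \<in> test_functions"
  shows "C1c_GL2 F (\<lambda>A. frechet_derivative F (at A))"
proof -
  define S where "S = closure {A. F A \<noteq> 0}"
  have "Ck_on 1 GL2 F"
    using assms unfolding test_functions_def smooth_on_def by blast
  then have d: "F differentiable (at A)" and c: "continuous_on GL2 (\<lambda>A. frechet_derivative F (at A) X)"
    if "A \<in> GL2" for A X
    using that by auto
  have S: "compact S" "S \<subseteq> GL2"
    using assms by (auto simp: test_functions_def S_def)
  have oS: "open (- S)"
    by (simp add: S_def open_Compl)
  have F0: "F A = 0" if "A \<in> - S" for A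
    using that closure_subset[of "{A. F A \<noteq> 0}"] by (auto simp: S_def)
  have D0: "(F has_derivative (\<lambda>_. 0)) (at A)" if "A \<in> - S" for A
    by (rule has_derivative_transform_within_open[OF has_derivative_const oS that]) (simp add: F0)
  have diff: "F differentiable (at A)" for A
    using d D0 S(2) by (cases "A \<in> S") (auto simp: differentiable_def)
  have D: "(F has_derivative frechet_derivative F (at A)) (at A)" for A
    using diff frechet_derivative_works by blast
  have fd0: "frechet_derivative F (at A) X = 0" if "A \<in> - S" for A X
    using has_derivative_unique[OF D D0[OF that]] by simp
  have "continuous_on UNIV F"
    using diff by (meson differentiable_imp_continuous_on differentiable_at_withinI differentiable_on_def)
  then have F: "F \<in> Cc_GL2"
    using S by (simp add: Cc_GL2_def S_def)
  have "(\<lambda>A. frechet_derivative F (at A) X) \<in> Cc_GL2" for X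
  proof (rule Cc_GL2_mono[OF F])
    have "continuous_on (- S) (\<lambda>A. frechet_derivative F (at A) X)"
      by (rule continuous_on_eq[OF continuous_on_const[of "- S" 0]]) (metis fd0)
    moreover have "continuous_on GL2 (\<lambda>A. frechet_derivative F (at A) X)"
      using c[of "mat 1"] by (simp add: mem_GL2)
    ultimately have "continuous_on (GL2 \<union> - S) (\<lambda>A. frechet_derivative F (at A) X)"
      by (intro continuous_on_open_Un oS open_GL2)
    moreover have "GL2 \<union> - S = UNIV" using S(2) by blast
    ultimately show "continuous_on UNIV (\<lambda>A. frechet_derivative F (at A) X)" by simp
  qed (use fd0 in \<open>auto simp: S_def\<close>)
  with F D show ?thesis by (simp add: C1c_GL2_def)
qed

lemma entry_deriv_eq:
  assumes "C1c_GL2 F F'"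
  shows "entry_deriv i j F = (\<lambda>A. F' A (axis i (axis j 1)))"
  unfolding entry_deriv_def
proof (intro ext vector_derivative_at)
  show "((\<lambda>h. F (A + h *\<^sub>R axis i (axis j 1))) has_vector_derivative F' A (axis i (axis j 1))) (at 0)" for A
    using has_vector_derivative_along_line[OF C1c_GL2_dest(2)[OF assms], of A "axis i (axis j 1)" 0] by simp
qed

section \<open>Rules for the kernel\<close>

lemma integrable_kernel:
  assumes "F \<in> Cc_GL2"
  shows "integrable lborel (\<lambda>p. F (chart t s p) * weight \<mu>\<^sub>1 \<epsilon>\<^sub>1 \<mu>\<^sub>2 \<epsilon>\<^sub>2 p)"
proof (rule integrable_continuous_bounded_support)
  show "continuous_on UNIV (\<lambda>p. F (chart t s p) * weight \<mu>\<^sub>1 \<epsilon>\<^sub>1 \<mu>\<^sub>2 \<epsilon>\<^sub>2 p)"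
    by (intro continuous_on_pullback assms continuous_intros)
  show "bounded {p. F (chart t s p) * weight \<mu>\<^sub>1 \<epsilon>\<^sub>1 \<mu>\<^sub>2 \<epsilon>\<^sub>2 p \<noteq> 0}"
    using bounded_chart_support[OF assms, of "{t}" "{s}"] by (auto elim: bounded_subset)
qed

lemma fourier_kernel_add:
  assumes "F \<in> Cc_GL2" "G \<in> Cc_GL2"
  shows "fourier_kernel (\<lambda>A. F A + G A) t s \<mu>\<^sub>1 \<epsilon>\<^sub>1 \<mu>\<^sub>2 \<epsilon>\<^sub>2 =
    fourier_kernel F t s \<mu>\<^sub>1 \<epsilon>\<^sub>1 \<mu>\<^sub>2 \<epsilon>\<^sub>2 + fourier_kernel G t s \<mu>\<^sub>1 \<epsilon>\<^sub>1 \<mu>\<^sub>2 \<epsilon>\<^sub>2"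
  using assms by (simp add: fourier_kernel_eq distrib_right integrable_kernel)

lemma fourier_kernel_cmult:
  "fourier_kernel (\<lambda>A. c * F A) t s \<mu>\<^sub>1 \<epsilon>\<^sub>1 \<mu>\<^sub>2 \<epsilon>\<^sub>2 = c * fourier_kernel F t s \<mu>\<^sub>1 \<epsilon>\<^sub>1 \<mu>\<^sub>2 \<epsilon>\<^sub>2"
  by (simp add: fourier_kernel_eq mult.assoc)

lemma weight_shift:
  "weight (\<mu>\<^sub>1 + 1) (\<epsilon>\<^sub>1 + 1) \<mu>\<^sub>2 \<epsilon>\<^sub>2 p = of_real (fst p) * weight \<mu>\<^sub>1 \<epsilon>\<^sub>1 \<mu>\<^sub>2 \<epsilon>\<^sub>2 p"
  "weight \<mu>\<^sub>1 \<epsilon>\<^sub>1 (\<mu>\<^sub>2 + 1) (\<epsilon>\<^sub>2 + 1) p = of_real (snd (snd p)) * weight \<mu>\<^sub>1 \<epsilon>\<^sub>1 \<mu>\<^sub>2 \<epsilon>\<^sub>2 p"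
  using signed_powr_add_1[of "fst p" "- 3 / 2 + \<mu>\<^sub>1" \<epsilon>\<^sub>1] signed_powr_add_1[of "snd (snd p)" "- 3 / 2 + \<mu>\<^sub>2" \<epsilon>\<^sub>2]
  by (simp_all add: weight_def case_prod_unfold algebra_simps)

text \<open>
  Where \<open>u w \<noteq> 0\<close> this is the product rule. Where \<open>u w = 0\<close> the powers need not be differentiable, but
  the product vanishes on a neighbourhood, and so does every term on the right-hand side.
\<close>

lemma has_vector_derivative_pullback:
  assumes F: "C1c_GL2 F F'"
  shows "((\<lambda>x. F (chart t s (p + x *\<^sub>R e)) * weight \<mu>\<^sub>1 \<epsilon>\<^sub>1 \<mu>\<^sub>2 \<epsilon>\<^sub>2 (p + x *\<^sub>R e)) has_vector_derivative
      F' (chart t s p) (chart t s e) * weight \<mu>\<^sub>1 \<epsilon>\<^sub>1 \<mu>\<^sub>2 \<epsilon>\<^sub>2 p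
      + of_real (fst e) * (- 3 / 2 + \<mu>\<^sub>1) * (F (chart t s p) * weight (\<mu>\<^sub>1 - 1) (\<epsilon>\<^sub>1 - 1) \<mu>\<^sub>2 \<epsilon>\<^sub>2 p)
      + of_real (snd (snd e)) * (- 3 / 2 + \<mu>\<^sub>2) * (F (chart t s p) * weight \<mu>\<^sub>1 \<epsilon>\<^sub>1 (\<mu>\<^sub>2 - 1) (\<epsilon>\<^sub>2 - 1) p)) (at 0)"
    (is "(?f has_vector_derivative ?d) _")
proof (cases "fst p * snd (snd p) = 0")
  case True
  let ?S = "closure {A. F A \<noteq> 0}"
  let ?U = "(\<lambda>x. chart t s (p + x *\<^sub>R e)) -` (- ?S)"
  have det0: "det (chart t s p) = 0"
    using True by (simp add: det_chart)
  then have z: "F (chart t s p) = 0" "F' (chart t s p) (chart t s e) = 0"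
    using Cc_GL2_zero[OF C1c_GL2_dest(1)[OF F]] Cc_GL2_zero[OF C1c_GL2_dest(3)[OF F]] by auto
  have "open ?U"
    by (intro open_vimage continuous_intros) (simp add: open_Compl)
  moreover have "0 \<in> ?U"
    using det0 C1c_GL2_dest(1)[OF F] by (auto simp: Cc_GL2_def mem_GL2)
  moreover have "0 = ?f x" if "x \<in> ?U" for x
    using that closure_subset[of "{A. F A \<noteq> 0}"] by auto
  ultimately have "(?f has_vector_derivative 0) (at 0)"
    by (rule has_vector_derivative_transform_within_open[OF has_vector_derivative_const])
  then show ?thesis by (simp add: z)
next
  case False
  have powr: "((\<lambda>x. signed_powr (a + x * b) \<mu> \<epsilon>) has_vector_derivative
      of_real b * (\<mu> * signed_powr a (\<mu> - 1) (\<epsilon> - 1))) (at 0)" if "a \<noteq> 0" for a b \<mu> \<epsilon>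
  proof -
    have "((\<lambda>x. a + x * b) has_vector_derivative b) (at 0)"
      by (auto intro!: derivative_eq_intros simp: has_real_derivative_iff_has_vector_derivative[symmetric])
    moreover have "((\<lambda>x. signed_powr x \<mu> \<epsilon>) has_vector_derivative \<mu> * signed_powr a (\<mu> - 1) (\<epsilon> - 1)) (at (a + 0 * b))"
      using has_vector_derivative_signed_powr[OF that] by simp
    ultimately show ?thesis
      using vector_diff_chain_at by (fastforce simp: o_def scaleR_conv_of_real)
  qed
  have "((\<lambda>x. F (chart t s p + x *\<^sub>R chart t s e)) has_vector_derivative F' (chart t s p) (chart t s e)) (at 0)"
    using has_vector_derivative_along_line[OF C1c_GL2_dest(2)[OF F], of "chart t s p" "chart t s e" 0] by simp
  from has_vector_derivative_mult[OF this
      has_vector_derivative_mult[OF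
        powr[of "fst p" "fst e" "- 3 / 2 + \<mu>\<^sub>1" \<epsilon>\<^sub>1] powr[of "snd (snd p)" "snd (snd e)" "- 3 / 2 + \<mu>\<^sub>2" \<epsilon>\<^sub>2]]]
  have "(?f has_vector_derivative
      F (chart t s p) *
        (signed_powr (fst p) (- 3 / 2 + \<mu>\<^sub>1) \<epsilon>\<^sub>1 *
          (of_real (snd (snd e)) * ((- 3 / 2 + \<mu>\<^sub>2) * signed_powr (snd (snd p)) (- 3 / 2 + \<mu>\<^sub>2 - 1) (\<epsilon>\<^sub>2 - 1))) +
        of_real (fst e) * ((- 3 / 2 + \<mu>\<^sub>1) * signed_powr (fst p) (- 3 / 2 + \<mu>\<^sub>1 - 1) (\<epsilon>\<^sub>1 - 1)) *
          signed_powr (snd (snd p)) (- 3 / 2 + \<mu>\<^sub>2) \<epsilon>\<^sub>2) +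
      F' (chart t s p) (chart t s e) * weight \<mu>\<^sub>1 \<epsilon>\<^sub>1 \<mu>\<^sub>2 \<epsilon>\<^sub>2 p) (at 0)"
    using False by (simp add: chart_add_scaleR weight_def case_prod_unfold)
  then show ?thesis
    by (rule has_vector_derivative_eq_rhs) (simp only: weight_def case_prod_unfold add_diff_eq, simp only: ring_distribs mult_ac add_ac)
qed

text \<open>
  Integration by parts moves the derivative along \<open>e = (e\<^sub>1, e\<^sub>2, e\<^sub>3)\<close> from \<open>F\<close> to the weight, which
  does not involve \<open>v\<close>; hence \<open>e\<^sub>2\<close> does not appear on the right-hand side.
\<close>

lemma fourier_kernel_directional_derivative:
  assumes F: "C1c_GL2 F F'"
  shows "fourier_kernel (\<lambda>A. F' A (chart t s e)) t s \<mu>\<^sub>1 \<epsilon>\<^sub>1 \<mu>\<^sub>2 \<epsilon>\<^sub>2 =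
    of_real (fst e) * (3 / 2 - \<mu>\<^sub>1) * fourier_kernel F t s (\<mu>\<^sub>1 - 1) (\<epsilon>\<^sub>1 - 1) \<mu>\<^sub>2 \<epsilon>\<^sub>2
    + of_real (snd (snd e)) * (3 / 2 - \<mu>\<^sub>2) * fourier_kernel F t s \<mu>\<^sub>1 \<epsilon>\<^sub>1 (\<mu>\<^sub>2 - 1) (\<epsilon>\<^sub>2 - 1)"
proof -
  note F' = C1c_GL2_dest[OF F]
  have "(\<integral>p. F' (chart t s p) (chart t s e) * weight \<mu>\<^sub>1 \<epsilon>\<^sub>1 \<mu>\<^sub>2 \<epsilon>\<^sub>2 p
      + of_real (fst e) * (- 3 / 2 + \<mu>\<^sub>1) * (F (chart t s p) * weight (\<mu>\<^sub>1 - 1) (\<epsilon>\<^sub>1 - 1) \<mu>\<^sub>2 \<epsilon>\<^sub>2 p)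
      + of_real (snd (snd e)) * (- 3 / 2 + \<mu>\<^sub>2) * (F (chart t s p) * weight \<mu>\<^sub>1 \<epsilon>\<^sub>1 (\<mu>\<^sub>2 - 1) (\<epsilon>\<^sub>2 - 1) p)
      \<partial>lborel) = 0"
  proof (rule integral_directional_derivative_eq_0[OF has_vector_derivative_pullback[OF F]])
    show "bounded {p. F (chart t s p) * weight \<mu>\<^sub>1 \<epsilon>\<^sub>1 \<mu>\<^sub>2 \<epsilon>\<^sub>2 p \<noteq> 0}"
      using bounded_chart_support[OF F'(1), of "{t}" "{s}"] by (auto elim: bounded_subset)
    have cont: "continuous_on UNIV (\<lambda>p. G (chart t s p) * weight \<nu>\<^sub>1 \<delta>\<^sub>1 \<nu>\<^sub>2 \<delta>\<^sub>2 p)"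
      if "G \<in> Cc_GL2" for G \<nu>\<^sub>1 \<delta>\<^sub>1 \<nu>\<^sub>2 \<delta>\<^sub>2
      by (rule continuous_on_pullback[OF that]) (intro continuous_intros)+
    show "continuous_on UNIV (\<lambda>p. F (chart t s p) * weight \<mu>\<^sub>1 \<epsilon>\<^sub>1 \<mu>\<^sub>2 \<epsilon>\<^sub>2 p)"
      by (rule cont[OF F'(1)])
    show "continuous_on UNIV (\<lambda>p. F' (chart t s p) (chart t s e) * weight \<mu>\<^sub>1 \<epsilon>\<^sub>1 \<mu>\<^sub>2 \<epsilon>\<^sub>2 p
      + of_real (fst e) * (- 3 / 2 + \<mu>\<^sub>1) * (F (chart t s p) * weight (\<mu>\<^sub>1 - 1) (\<epsilon>\<^sub>1 - 1) \<mu>\<^sub>2 \<epsilon>\<^sub>2 p)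
      + of_real (snd (snd e)) * (- 3 / 2 + \<mu>\<^sub>2) * (F (chart t s p) * weight \<mu>\<^sub>1 \<epsilon>\<^sub>1 (\<mu>\<^sub>2 - 1) (\<epsilon>\<^sub>2 - 1) p))"
      by (intro continuous_on_add continuous_on_mult[OF continuous_on_const] cont[OF F'(1)] cont[OF F'(3)])
  qed
  moreover have "integrable lborel (\<lambda>p. F' (chart t s p) (chart t s e) * weight \<mu>\<^sub>1 \<epsilon>\<^sub>1 \<mu>\<^sub>2 \<epsilon>\<^sub>2 p)"
    by (rule integrable_kernel[OF F'(3)])
  ultimately show ?thesis
    using integrable_kernel[OF F'(1)] by (simp add: fourier_kernel_eq algebra_simps)
qed

section \<open>Derivatives of the kernel in its variables\<close>

text \<open>
  With \<open>t\<close> the chart moves in the direction \<open>X = - v (1, s; 0, 0) - w (0, 1; 0, 0)\<close>, rows being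
  separated by a semicolon. The first matrix is the
  direction of \<open>u\<close>, and \<open>v\<close> is the lower left entry, so the first term is a derivative of
  \<open>A $ 2 $ 1 * F A\<close> along \<open>u\<close> and can be integrated by parts. The factor \<open>w\<close> of the second term
  raises \<open>\<mu>\<^sub>2\<close>.
\<close>

lemma fourier_kernel_has_vector_derivative_t:
  assumes F: "C1c_GL2 F F'"
  shows "((\<lambda>t. fourier_kernel F t s \<mu>\<^sub>1 \<epsilon>\<^sub>1 \<mu>\<^sub>2 \<epsilon>\<^sub>2) has_vector_derivative
    - (3 / 2 - \<mu>\<^sub>1) * fourier_kernel (\<lambda>A. of_real (A $ 2 $ 1) * F A) t s (\<mu>\<^sub>1 - 1) (\<epsilon>\<^sub>1 - 1) \<mu>\<^sub>2 \<epsilon>\<^sub>2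
    - fourier_kernel (\<lambda>A. F' A (mat2 0 1 0 0)) t s \<mu>\<^sub>1 \<epsilon>\<^sub>1 (\<mu>\<^sub>2 + 1) (\<epsilon>\<^sub>2 + 1)) (at t)"
proof -
  note F' = C1c_GL2_dest[OF F]
  let ?c = "\<lambda>A. complex_of_real (A $ 2 $ 1)"
  let ?w = "weight \<mu>\<^sub>1 \<epsilon>\<^sub>1 \<mu>\<^sub>2 \<epsilon>\<^sub>2"
  let ?F1 = "\<lambda>A. ?c A * F' A (mat2 1 s 0 0)" and ?F2 = "\<lambda>A. F' A (mat2 0 1 0 0)"
  have F1: "?F1 \<in> Cc_GL2"
    by (intro Cc_GL2_mult F' continuous_on_entry)
  let ?f' = "\<lambda>t p. - (?F1 (chart t s p) * ?w p) - ?F2 (chart t s p) * weight \<mu>\<^sub>1 \<epsilon>\<^sub>1 (\<mu>\<^sub>2 + 1) (\<epsilon>\<^sub>2 + 1) p"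
  have "((\<lambda>t. \<integral>p. F (chart t s p) * ?w p \<partial>lborel) has_vector_derivative (\<integral>p. ?f' t p \<partial>lborel)) (at t)"
  proof (rule has_vector_derivative_integral_lborel)
    fix x :: real and p :: "real \<times> real \<times> real"
    obtain u v w where p: "p = (u, v, w)" by (cases p)
    define X where "X = mat2 (- v) (- (s * v + w)) 0 0"
    have X: "X = (- v) *\<^sub>R mat2 1 s 0 0 + (- w) *\<^sub>R mat2 0 1 0 0"
      unfolding X_def by (rule mat2_eqI) simp_all
    have lin: "F' A X = - of_real v * F' A (mat2 1 s 0 0) - of_real w * F' A (mat2 0 1 0 0)" for A
      unfolding X linear_add[OF F'(4)] linear_scale[OF F'(4)] by (simp add: scaleR_conv_of_real)
    define B where "B = chart 0 s p"
    have ch: "chart y s p = B + y *\<^sub>R X" for y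
      unfolding X_def B_def p by (rule mat2_eqI) (simp_all add: chart_def algebra_simps)
    have "((\<lambda>y. F (chart y s p)) has_vector_derivative F' (chart x s p) X) (at x)"
      unfolding ch by (rule has_vector_derivative_along_line[OF F'(2)])
    then have "((\<lambda>y. F (chart y s p) * ?w p) has_vector_derivative F' (chart x s p) X * ?w p) (at x)"
      by (rule has_vector_derivative_mult_left)
    also have "F' (chart x s p) X * ?w p = ?f' x p"
      unfolding lin weight_shift by (simp add: p chart_def algebra_simps)
    finally show "((\<lambda>y. F (chart y s p) * ?w p) has_vector_derivative ?f' x p) (at x)" .
  next
    show "continuous_on UNIV (\<lambda>p. F (chart x s p) * ?w p)" for x
      by (intro continuous_on_pullback F' continuous_intros)
    show "continuous_on UNIV (\<lambda>(x, p). ?f' x p)"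
      unfolding case_prod_unfold
      by (intro continuous_on_diff continuous_on_minus continuous_on_pullback[OF F1] continuous_on_pullback[OF F'(3)] continuous_intros)
    show "bounded (\<Union>x\<in>cball t 1. {p. F (chart x s p) * ?w p \<noteq> 0})"
      using bounded_chart_support[OF F'(1), of "cball t 1" "{s}"] by (rule bounded_subset) auto
  qed
  moreover have "(\<integral>p. ?f' t p \<partial>lborel) = - fourier_kernel ?F1 t s \<mu>\<^sub>1 \<epsilon>\<^sub>1 \<mu>\<^sub>2 \<epsilon>\<^sub>2
      - fourier_kernel ?F2 t s \<mu>\<^sub>1 \<epsilon>\<^sub>1 (\<mu>\<^sub>2 + 1) (\<epsilon>\<^sub>2 + 1)"
    unfolding fourier_kernel_eq
    using integrable_kernel[OF F1] integrable_kernel[OF F'(3)] by simp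
  moreover have "fourier_kernel ?F1 t s \<mu>\<^sub>1 \<epsilon>\<^sub>1 \<mu>\<^sub>2 \<epsilon>\<^sub>2 =
      (3 / 2 - \<mu>\<^sub>1) * fourier_kernel (\<lambda>A. ?c A * F A) t s (\<mu>\<^sub>1 - 1) (\<epsilon>\<^sub>1 - 1) \<mu>\<^sub>2 \<epsilon>\<^sub>2"
    using fourier_kernel_directional_derivative[OF C1c_GL2_mult_entry[OF F, of 2 1], of t s "(1, 0, 0)"]
    by (simp add: chart_def)
  ultimately show ?thesis
    unfolding fourier_kernel_eq[of F] by (simp only: minus_mult_left)
qed

text \<open>
  With \<open>s\<close> the chart moves in the direction \<open>v (0, -t; 0, 1) + u (0, 1; 0, 0)\<close>, whose first matrix is
  the direction of \<open>w\<close>; otherwise the roles of \<open>u\<close> and \<open>w\<close> are exchanged.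
\<close>

lemma fourier_kernel_has_vector_derivative_s:
  assumes F: "C1c_GL2 F F'"
  shows "((\<lambda>s. fourier_kernel F t s \<mu>\<^sub>1 \<epsilon>\<^sub>1 \<mu>\<^sub>2 \<epsilon>\<^sub>2) has_vector_derivative
    (3 / 2 - \<mu>\<^sub>2) * fourier_kernel (\<lambda>A. of_real (A $ 2 $ 1) * F A) t s \<mu>\<^sub>1 \<epsilon>\<^sub>1 (\<mu>\<^sub>2 - 1) (\<epsilon>\<^sub>2 - 1)
    + fourier_kernel (\<lambda>A. F' A (mat2 0 1 0 0)) t s (\<mu>\<^sub>1 + 1) (\<epsilon>\<^sub>1 + 1) \<mu>\<^sub>2 \<epsilon>\<^sub>2) (at s)"
proof -
  note F' = C1c_GL2_dest[OF F]
  let ?c = "\<lambda>A. complex_of_real (A $ 2 $ 1)"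
  let ?w = "weight \<mu>\<^sub>1 \<epsilon>\<^sub>1 \<mu>\<^sub>2 \<epsilon>\<^sub>2"
  let ?F1 = "\<lambda>A. ?c A * F' A (mat2 0 (- t) 0 1)" and ?F2 = "\<lambda>A. F' A (mat2 0 1 0 0)"
  have F1: "?F1 \<in> Cc_GL2"
    by (intro Cc_GL2_mult F' continuous_on_entry)
  let ?f' = "\<lambda>s p. ?F1 (chart t s p) * ?w p + ?F2 (chart t s p) * weight (\<mu>\<^sub>1 + 1) (\<epsilon>\<^sub>1 + 1) \<mu>\<^sub>2 \<epsilon>\<^sub>2 p"
  have "((\<lambda>s. \<integral>p. F (chart t s p) * ?w p \<partial>lborel) has_vector_derivative (\<integral>p. ?f' s p \<partial>lborel)) (at s)"
  proof (rule has_vector_derivative_integral_lborel)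
    fix x :: real and p :: "real \<times> real \<times> real"
    obtain u v w where p: "p = (u, v, w)" by (cases p)
    define X where "X = mat2 0 (u - t * v) 0 v"
    have X: "X = v *\<^sub>R mat2 0 (- t) 0 1 + u *\<^sub>R mat2 0 1 0 0"
      unfolding X_def by (rule mat2_eqI) simp_all
    have lin: "F' A X = of_real v * F' A (mat2 0 (- t) 0 1) + of_real u * F' A (mat2 0 1 0 0)" for A
      unfolding X linear_add[OF F'(4)] linear_scale[OF F'(4)] by (simp add: scaleR_conv_of_real)
    define B where "B = chart t 0 p"
    have ch: "chart t y p = B + y *\<^sub>R X" for y
      unfolding X_def B_def p by (rule mat2_eqI) (simp_all add: chart_def algebra_simps)
    have "((\<lambda>y. F (chart t y p)) has_vector_derivative F' (chart t x p) X) (at x)"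
      unfolding ch by (rule has_vector_derivative_along_line[OF F'(2)])
    then have "((\<lambda>y. F (chart t y p) * ?w p) has_vector_derivative F' (chart t x p) X * ?w p) (at x)"
      by (rule has_vector_derivative_mult_left)
    also have "F' (chart t x p) X * ?w p = ?f' x p"
      unfolding lin weight_shift by (simp add: p chart_def algebra_simps)
    finally show "((\<lambda>y. F (chart t y p) * ?w p) has_vector_derivative ?f' x p) (at x)" .
  next
    show "continuous_on UNIV (\<lambda>p. F (chart t x p) * ?w p)" for x
      by (intro continuous_on_pullback F' continuous_intros)
    show "continuous_on UNIV (\<lambda>(x, p). ?f' x p)"
      unfolding case_prod_unfold
      by (intro continuous_on_add continuous_on_pullback[OF F1] continuous_on_pullback[OF F'(3)] continuous_intros)
    show "bounded (\<Union>x\<in>cball s 1. {p. F (chart t x p) * ?w p \<noteq> 0})"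
      using bounded_chart_support[OF F'(1), of "{t}" "cball s 1"] by (rule bounded_subset) auto
  qed
  moreover have "(\<integral>p. ?f' s p \<partial>lborel) = fourier_kernel ?F1 t s \<mu>\<^sub>1 \<epsilon>\<^sub>1 \<mu>\<^sub>2 \<epsilon>\<^sub>2
      + fourier_kernel ?F2 t s (\<mu>\<^sub>1 + 1) (\<epsilon>\<^sub>1 + 1) \<mu>\<^sub>2 \<epsilon>\<^sub>2"
    unfolding fourier_kernel_eq
    using integrable_kernel[OF F1] integrable_kernel[OF F'(3)] by simp
  moreover have "fourier_kernel ?F1 t s \<mu>\<^sub>1 \<epsilon>\<^sub>1 \<mu>\<^sub>2 \<epsilon>\<^sub>2 =
      (3 / 2 - \<mu>\<^sub>2) * fourier_kernel (\<lambda>A. ?c A * F A) t s \<mu>\<^sub>1 \<epsilon>\<^sub>1 (\<mu>\<^sub>2 - 1) (\<epsilon>\<^sub>2 - 1)"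
    using fourier_kernel_directional_derivative[OF C1c_GL2_mult_entry[OF F, of 2 1], of t s "(0, 0, 1)"]
    by (simp add: chart_def)
  ultimately show ?thesis
    unfolding fourier_kernel_eq[of F] by (simp only: minus_mult_left)
qed

section \<open>The Fourier-images\<close>

text \<open>
  In the chart \<open>a = u - t c\<close>, \<open>b = s u - t w - s t c\<close> and \<open>d = w + s c\<close>, and multiplication by \<open>u\<close>
  and \<open>w\<close> amounts to the two shifts.
\<close>

lemma fourier_kernel_mult_entries:
  assumes F: "F \<in> Cc_GL2"
  defines "Kc \<equiv> fourier_kernel (\<lambda>A. of_real (A $ 2 $ 1) * F A)"
  shows "fourier_kernel (\<lambda>A. of_real (A $ 1 $ 1) * F A) t s \<mu>\<^sub>1 \<epsilon>\<^sub>1 \<mu>\<^sub>2 \<epsilon>\<^sub>2 =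
      V1 (fourier_kernel F) t s \<mu>\<^sub>1 \<epsilon>\<^sub>1 \<mu>\<^sub>2 \<epsilon>\<^sub>2 - of_real t * Kc t s \<mu>\<^sub>1 \<epsilon>\<^sub>1 \<mu>\<^sub>2 \<epsilon>\<^sub>2" (is ?a)
    and "fourier_kernel (\<lambda>A. of_real (A $ 1 $ 2) * F A) t s \<mu>\<^sub>1 \<epsilon>\<^sub>1 \<mu>\<^sub>2 \<epsilon>\<^sub>2 =
      of_real s * V1 (fourier_kernel F) t s \<mu>\<^sub>1 \<epsilon>\<^sub>1 \<mu>\<^sub>2 \<epsilon>\<^sub>2 - of_real t * V2 (fourier_kernel F) t s \<mu>\<^sub>1 \<epsilon>\<^sub>1 \<mu>\<^sub>2 \<epsilon>\<^sub>2
      - of_real s * of_real t * Kc t s \<mu>\<^sub>1 \<epsilon>\<^sub>1 \<mu>\<^sub>2 \<epsilon>\<^sub>2" (is ?b)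
    and "fourier_kernel (\<lambda>A. of_real (A $ 2 $ 2) * F A) t s \<mu>\<^sub>1 \<epsilon>\<^sub>1 \<mu>\<^sub>2 \<epsilon>\<^sub>2 =
      V2 (fourier_kernel F) t s \<mu>\<^sub>1 \<epsilon>\<^sub>1 \<mu>\<^sub>2 \<epsilon>\<^sub>2 + of_real s * Kc t s \<mu>\<^sub>1 \<epsilon>\<^sub>1 \<mu>\<^sub>2 \<epsilon>\<^sub>2" (is ?d)
proof -
  let ?w = "weight \<mu>\<^sub>1 \<epsilon>\<^sub>1 \<mu>\<^sub>2 \<epsilon>\<^sub>2"
  let ?I1 = "\<lambda>p. F (chart t s p) * weight (\<mu>\<^sub>1 + 1) (\<epsilon>\<^sub>1 + 1) \<mu>\<^sub>2 \<epsilon>\<^sub>2 p"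
  let ?I2 = "\<lambda>p. F (chart t s p) * weight \<mu>\<^sub>1 \<epsilon>\<^sub>1 (\<mu>\<^sub>2 + 1) (\<epsilon>\<^sub>2 + 1) p"
  let ?Ic = "\<lambda>p. (of_real (chart t s p $ 2 $ 1) * F (chart t s p)) * ?w p"
  have int: "integrable lborel ?I1" "integrable lborel ?I2" "integrable lborel ?Ic"
    by (intro integrable_kernel Cc_GL2_mult continuous_on_entry F)+
  note shift = V1_def V2_def Kc_def fourier_kernel_eq
  have "(of_real (chart t s p $ 1 $ 1) * F (chart t s p)) * ?w p = ?I1 p - of_real t * ?Ic p" for p
    by (simp only: weight_shift) (simp add: chart_def case_prod_unfold algebra_simps)
  then show ?a
    unfolding shift using int by simp
  have "(of_real (chart t s p $ 1 $ 2) * F (chart t s p)) * ?w p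
      = of_real s * ?I1 p - of_real t * ?I2 p - of_real s * of_real t * ?Ic p" for p
    by (simp only: weight_shift) (simp add: chart_def case_prod_unfold algebra_simps)
  then show ?b
    unfolding shift using int by simp
  have "(of_real (chart t s p $ 2 $ 2) * F (chart t s p)) * ?w p = ?I2 p + of_real s * ?Ic p" for p
    by (simp only: weight_shift) (simp add: chart_def case_prod_unfold algebra_simps)
  then show ?d
    unfolding shift using int by simp
qed

lemma fourier_kernel_inverse_det:
  assumes F: "F \<in> Cc_GL2"
  shows "fourier_kernel (\<lambda>A. of_real (inverse (det A)) * F A) = V1_inv (V2_inv (fourier_kernel F))"
proof (intro ext)
  fix t s \<mu>\<^sub>1 \<epsilon>\<^sub>1 \<mu>\<^sub>2 \<epsilon>\<^sub>2
  have "of_real (inverse (det (chart t s p))) * F (chart t s p) * weight \<mu>\<^sub>1 \<epsilon>\<^sub>1 \<mu>\<^sub>2 \<epsilon>\<^sub>2 p =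
      F (chart t s p) * weight (\<mu>\<^sub>1 - 1) (\<epsilon>\<^sub>1 - 1) (\<mu>\<^sub>2 - 1) (\<epsilon>\<^sub>2 - 1) p" for p
  proof (cases "det (chart t s p) = 0")
    case False
    have "weight \<mu>\<^sub>1 \<epsilon>\<^sub>1 \<mu>\<^sub>2 \<epsilon>\<^sub>2 p =
        of_real (det (chart t s p)) * weight (\<mu>\<^sub>1 - 1) (\<epsilon>\<^sub>1 - 1) (\<mu>\<^sub>2 - 1) (\<epsilon>\<^sub>2 - 1) p"
      using weight_shift(1)[of "\<mu>\<^sub>1 - 1" "\<epsilon>\<^sub>1 - 1" \<mu>\<^sub>2 \<epsilon>\<^sub>2 p]
        weight_shift(2)[of "\<mu>\<^sub>1 - 1" "\<epsilon>\<^sub>1 - 1" "\<mu>\<^sub>2 - 1" "\<epsilon>\<^sub>2 - 1" p]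
      by (simp only: diff_add_cancel det_chart of_real_mult mult.assoc)
    with False show ?thesis by simp
  qed (simp add: Cc_GL2_zero[OF F])
  then show "fourier_kernel (\<lambda>A. of_real (inverse (det A)) * F A) t s \<mu>\<^sub>1 \<epsilon>\<^sub>1 \<mu>\<^sub>2 \<epsilon>\<^sub>2
      = V1_inv (V2_inv (fourier_kernel F)) t s \<mu>\<^sub>1 \<epsilon>\<^sub>1 \<mu>\<^sub>2 \<epsilon>\<^sub>2"
    by (simp only: V1_inv_def V2_inv_def fourier_kernel_eq)
qed

text \<open>
  After the shifts by \<open>V1\<close> and \<open>V2\<close> both derivatives contain the derivative of \<open>F\<close> in the entry \<open>b\<close>
  with parameters \<open>(\<mu>\<^sub>1 + 1, \<mu>\<^sub>2 + 1)\<close> and opposite signs. The kernels of \<open>c F\<close> combine with coefficient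
  \<open>- (1/2 - \<mu>\<^sub>1) + (1/2 - \<mu>\<^sub>2)\<close>.
\<close>

lemma fourier_kernel_mult_entry_21:
  assumes F: "C1c_GL2 F F'" and "\<mu>\<^sub>1 \<noteq> \<mu>\<^sub>2"
  shows "fourier_kernel (\<lambda>A. of_real (A $ 2 $ 1) * F A) t s \<mu>\<^sub>1 \<epsilon>\<^sub>1 \<mu>\<^sub>2 \<epsilon>\<^sub>2 =
    1 / (\<mu>\<^sub>1 - \<mu>\<^sub>2) * (d_t (V1 (fourier_kernel F)) t s \<mu>\<^sub>1 \<epsilon>\<^sub>1 \<mu>\<^sub>2 \<epsilon>\<^sub>2
      + d_s (V2 (fourier_kernel F)) t s \<mu>\<^sub>1 \<epsilon>\<^sub>1 \<mu>\<^sub>2 \<epsilon>\<^sub>2)"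
proof -
  have "d_t (V1 (fourier_kernel F)) t s \<mu>\<^sub>1 \<epsilon>\<^sub>1 \<mu>\<^sub>2 \<epsilon>\<^sub>2 + d_s (V2 (fourier_kernel F)) t s \<mu>\<^sub>1 \<epsilon>\<^sub>1 \<mu>\<^sub>2 \<epsilon>\<^sub>2 =
      (\<mu>\<^sub>1 - \<mu>\<^sub>2) * fourier_kernel (\<lambda>A. of_real (A $ 2 $ 1) * F A) t s \<mu>\<^sub>1 \<epsilon>\<^sub>1 \<mu>\<^sub>2 \<epsilon>\<^sub>2"
    by (simp add: d_t_def d_s_def V1_def V2_def vector_derivative_at[OF fourier_kernel_has_vector_derivative_t[OF F]]
        vector_derivative_at[OF fourier_kernel_has_vector_derivative_s[OF F]] algebra_simps)
  with assms(2) show ?thesis by simp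
qed

text \<open>
  The weights \<open>3/2 - \<mu>\<^sub>1\<close> and \<open>3/2 - \<mu>\<^sub>2\<close> are those for which the kernels of \<open>c F\<close>, both with
  parameters \<open>(\<mu>\<^sub>1 - 1, \<mu>\<^sub>2 - 1)\<close>, cancel.
\<close>

lemma fourier_kernel_derivative_12:
  assumes F: "C1c_GL2 F F'" and "\<mu>\<^sub>1 \<noteq> \<mu>\<^sub>2"
  shows "fourier_kernel (\<lambda>A. F' A (mat2 0 1 0 0)) t s \<mu>\<^sub>1 \<epsilon>\<^sub>1 \<mu>\<^sub>2 \<epsilon>\<^sub>2 =
    - (1 / (\<mu>\<^sub>1 - \<mu>\<^sub>2)) * ((3 / 2 - \<mu>\<^sub>1) * d_s (V1_inv (fourier_kernel F)) t s \<mu>\<^sub>1 \<epsilon>\<^sub>1 \<mu>\<^sub>2 \<epsilon>\<^sub>2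
      + (3 / 2 - \<mu>\<^sub>2) * d_t (V2_inv (fourier_kernel F)) t s \<mu>\<^sub>1 \<epsilon>\<^sub>1 \<mu>\<^sub>2 \<epsilon>\<^sub>2)"
proof -
  have cancel: "x * (y * C + B) + y * (- x * C - B) = - ((y - x) * B)" for x y B C :: complex
    by (simp add: algebra_simps)
  have "(3 / 2 - \<mu>\<^sub>1) * d_s (V1_inv (fourier_kernel F)) t s \<mu>\<^sub>1 \<epsilon>\<^sub>1 \<mu>\<^sub>2 \<epsilon>\<^sub>2
      + (3 / 2 - \<mu>\<^sub>2) * d_t (V2_inv (fourier_kernel F)) t s \<mu>\<^sub>1 \<epsilon>\<^sub>1 \<mu>\<^sub>2 \<epsilon>\<^sub>2 =
      - ((\<mu>\<^sub>1 - \<mu>\<^sub>2) * fourier_kernel (\<lambda>A. F' A (mat2 0 1 0 0)) t s \<mu>\<^sub>1 \<epsilon>\<^sub>1 \<mu>\<^sub>2 \<epsilon>\<^sub>2)"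
    unfolding d_t_def d_s_def V1_inv_def V2_inv_def vector_derivative_at[OF fourier_kernel_has_vector_derivative_t[OF F]]
      vector_derivative_at[OF fourier_kernel_has_vector_derivative_s[OF F]] diff_add_cancel cancel
    by simp
  with assms(2) show ?thesis by simp
qed

text \<open>
  At fixed \<open>t\<close> and \<open>s\<close> the image of the chart is a hyperplane of the matrix space, and the matrix unit
  of the entry \<open>b\<close> spans a complement. Integration by parts applies to the first component of each
  of the other matrix units.
\<close>

lemma fourier_kernel_derivatives:
  assumes F: "C1c_GL2 F F'"
  defines "Kb \<equiv> fourier_kernel (\<lambda>A. F' A (mat2 0 1 0 0))"
  shows "fourier_kernel (\<lambda>A. F' A (mat2 1 0 0 0)) t s \<mu>\<^sub>1 \<epsilon>\<^sub>1 \<mu>\<^sub>2 \<epsilon>\<^sub>2 =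
      (3 / 2 - \<mu>\<^sub>1) * V1_inv (fourier_kernel F) t s \<mu>\<^sub>1 \<epsilon>\<^sub>1 \<mu>\<^sub>2 \<epsilon>\<^sub>2
      - of_real s * Kb t s \<mu>\<^sub>1 \<epsilon>\<^sub>1 \<mu>\<^sub>2 \<epsilon>\<^sub>2" (is ?a)
    and "fourier_kernel (\<lambda>A. F' A (mat2 0 0 1 0)) t s \<mu>\<^sub>1 \<epsilon>\<^sub>1 \<mu>\<^sub>2 \<epsilon>\<^sub>2 =
      (3 / 2 - \<mu>\<^sub>1) * of_real t * V1_inv (fourier_kernel F) t s \<mu>\<^sub>1 \<epsilon>\<^sub>1 \<mu>\<^sub>2 \<epsilon>\<^sub>2
      - (3 / 2 - \<mu>\<^sub>2) * of_real s * V2_inv (fourier_kernel F) t s \<mu>\<^sub>1 \<epsilon>\<^sub>1 \<mu>\<^sub>2 \<epsilon>\<^sub>2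
      - of_real s * of_real t * Kb t s \<mu>\<^sub>1 \<epsilon>\<^sub>1 \<mu>\<^sub>2 \<epsilon>\<^sub>2" (is ?c)
    and "fourier_kernel (\<lambda>A. F' A (mat2 0 0 0 1)) t s \<mu>\<^sub>1 \<epsilon>\<^sub>1 \<mu>\<^sub>2 \<epsilon>\<^sub>2 =
      (3 / 2 - \<mu>\<^sub>2) * V2_inv (fourier_kernel F) t s \<mu>\<^sub>1 \<epsilon>\<^sub>1 \<mu>\<^sub>2 \<epsilon>\<^sub>2
      + of_real t * Kb t s \<mu>\<^sub>1 \<epsilon>\<^sub>1 \<mu>\<^sub>2 \<epsilon>\<^sub>2" (is ?d)
proof -
  note F' = C1c_GL2_dest[OF F]
  have *: "fourier_kernel (\<lambda>A. F' A X) t s \<mu>\<^sub>1 \<epsilon>\<^sub>1 \<mu>\<^sub>2 \<epsilon>\<^sub>2 =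
      of_real (fst e) * (3 / 2 - \<mu>\<^sub>1) * V1_inv (fourier_kernel F) t s \<mu>\<^sub>1 \<epsilon>\<^sub>1 \<mu>\<^sub>2 \<epsilon>\<^sub>2
      + of_real (snd (snd e)) * (3 / 2 - \<mu>\<^sub>2) * V2_inv (fourier_kernel F) t s \<mu>\<^sub>1 \<epsilon>\<^sub>1 \<mu>\<^sub>2 \<epsilon>\<^sub>2
      + of_real k * Kb t s \<mu>\<^sub>1 \<epsilon>\<^sub>1 \<mu>\<^sub>2 \<epsilon>\<^sub>2"
    if X: "X = chart t s e + k *\<^sub>R mat2 0 1 0 0" for X e k
  proof -
    have "F' A X = F' A (chart t s e) + of_real k * F' A (mat2 0 1 0 0)" for A
      unfolding X linear_add[OF F'(4)] linear_scale[OF F'(4)] by (simp add: scaleR_conv_of_real)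
    moreover have "(\<lambda>A. of_real k * F' A (mat2 0 1 0 0)) \<in> Cc_GL2"
      by (intro Cc_GL2_mult F' continuous_intros)
    ultimately show ?thesis
      using fourier_kernel_directional_derivative[OF F, of t s e]
      by (simp add: fourier_kernel_add F' fourier_kernel_cmult Kb_def V1_inv_def V2_inv_def)
  qed
  have "mat2 1 0 0 0 = chart t s (1, 0, 0) + (- s) *\<^sub>R mat2 0 1 0 0"
    by (rule mat2_eqI) (simp_all add: chart_def)
  from *[OF this] show ?a by simp
  \<comment> \<open>\<open>v = c = 1\<close> is forced; \<open>u\<close> and \<open>w\<close> are then chosen to make the diagonal vanish.\<close>
  have "mat2 0 0 1 0 = chart t s (t, 1, - s) + (- (s * t)) *\<^sub>R mat2 0 1 0 0"
    by (rule mat2_eqI) (simp_all add: chart_def algebra_simps)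
  from *[OF this] show ?c by (simp add: mult_ac)
  have "mat2 0 0 0 1 = chart t s (0, 0, 1) + t *\<^sub>R mat2 0 1 0 0"
    by (rule mat2_eqI) (simp_all add: chart_def)
  from *[OF this] show ?d by simp
qed

theorem theorem1:
  shows
   "fourier_image_mero (\<lambda>F A. of_real (A $ 1 $ 1) * F A)
      (\<lambda>K t s \<mu>\<^sub>1 \<epsilon>\<^sub>1 \<mu>\<^sub>2 \<epsilon>\<^sub>2.
        V1 K t s \<mu>\<^sub>1 \<epsilon>\<^sub>1 \<mu>\<^sub>2 \<epsilon>\<^sub>2
        - of_real t / (\<mu>\<^sub>1 - \<mu>\<^sub>2)
          * (d_t (V1 K) t s \<mu>\<^sub>1 \<epsilon>\<^sub>1 \<mu>\<^sub>2 \<epsilon>\<^sub>2 + d_s (V2 K) t s \<mu>\<^sub>1 \<epsilon>\<^sub>1 \<mu>\<^sub>2 \<epsilon>\<^sub>2)) \<and>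
    fourier_image_mero (\<lambda>F A. of_real (A $ 1 $ 2) * F A)
      (\<lambda>K t s \<mu>\<^sub>1 \<epsilon>\<^sub>1 \<mu>\<^sub>2 \<epsilon>\<^sub>2.
        of_real s * V1 K t s \<mu>\<^sub>1 \<epsilon>\<^sub>1 \<mu>\<^sub>2 \<epsilon>\<^sub>2 - of_real t * V2 K t s \<mu>\<^sub>1 \<epsilon>\<^sub>1 \<mu>\<^sub>2 \<epsilon>\<^sub>2
        - of_real s * of_real t / (\<mu>\<^sub>1 - \<mu>\<^sub>2)
          * (d_t (V1 K) t s \<mu>\<^sub>1 \<epsilon>\<^sub>1 \<mu>\<^sub>2 \<epsilon>\<^sub>2 + d_s (V2 K) t s \<mu>\<^sub>1 \<epsilon>\<^sub>1 \<mu>\<^sub>2 \<epsilon>\<^sub>2)) \<and>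
    fourier_image_mero (\<lambda>F A. of_real (A $ 2 $ 1) * F A)
      (\<lambda>K t s \<mu>\<^sub>1 \<epsilon>\<^sub>1 \<mu>\<^sub>2 \<epsilon>\<^sub>2.
        1 / (\<mu>\<^sub>1 - \<mu>\<^sub>2)
          * (d_t (V1 K) t s \<mu>\<^sub>1 \<epsilon>\<^sub>1 \<mu>\<^sub>2 \<epsilon>\<^sub>2 + d_s (V2 K) t s \<mu>\<^sub>1 \<epsilon>\<^sub>1 \<mu>\<^sub>2 \<epsilon>\<^sub>2)) \<and>
    fourier_image_mero (\<lambda>F A. of_real (A $ 2 $ 2) * F A)
      (\<lambda>K t s \<mu>\<^sub>1 \<epsilon>\<^sub>1 \<mu>\<^sub>2 \<epsilon>\<^sub>2.
        V2 K t s \<mu>\<^sub>1 \<epsilon>\<^sub>1 \<mu>\<^sub>2 \<epsilon>\<^sub>2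
        + of_real s / (\<mu>\<^sub>1 - \<mu>\<^sub>2)
          * (d_t (V1 K) t s \<mu>\<^sub>1 \<epsilon>\<^sub>1 \<mu>\<^sub>2 \<epsilon>\<^sub>2 + d_s (V2 K) t s \<mu>\<^sub>1 \<epsilon>\<^sub>1 \<mu>\<^sub>2 \<epsilon>\<^sub>2)) \<and>
    fourier_image (\<lambda>F A. of_real (inverse (det A)) * F A) (\<lambda>K. V1_inv (V2_inv K)) \<and>
    fourier_image_mero (entry_deriv 1 1)
      (\<lambda>K t s \<mu>\<^sub>1 \<epsilon>\<^sub>1 \<mu>\<^sub>2 \<epsilon>\<^sub>2.
        (3 / 2 - \<mu>\<^sub>1) * V1_inv K t s \<mu>\<^sub>1 \<epsilon>\<^sub>1 \<mu>\<^sub>2 \<epsilon>\<^sub>2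
        + of_real s / (\<mu>\<^sub>1 - \<mu>\<^sub>2)
          * ((3 / 2 - \<mu>\<^sub>1) * d_s (V1_inv K) t s \<mu>\<^sub>1 \<epsilon>\<^sub>1 \<mu>\<^sub>2 \<epsilon>\<^sub>2
          + (3 / 2 - \<mu>\<^sub>2) * d_t (V2_inv K) t s \<mu>\<^sub>1 \<epsilon>\<^sub>1 \<mu>\<^sub>2 \<epsilon>\<^sub>2)) \<and>
    fourier_image_mero (entry_deriv 1 2)
      (\<lambda>K t s \<mu>\<^sub>1 \<epsilon>\<^sub>1 \<mu>\<^sub>2 \<epsilon>\<^sub>2.
        - (1 / (\<mu>\<^sub>1 - \<mu>\<^sub>2))
          * ((3 / 2 - \<mu>\<^sub>1) * d_s (V1_inv K) t s \<mu>\<^sub>1 \<epsilon>\<^sub>1 \<mu>\<^sub>2 \<epsilon>\<^sub>2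
          + (3 / 2 - \<mu>\<^sub>2) * d_t (V2_inv K) t s \<mu>\<^sub>1 \<epsilon>\<^sub>1 \<mu>\<^sub>2 \<epsilon>\<^sub>2)) \<and>
    fourier_image_mero (entry_deriv 2 1)
      (\<lambda>K t s \<mu>\<^sub>1 \<epsilon>\<^sub>1 \<mu>\<^sub>2 \<epsilon>\<^sub>2.
        (3 / 2 - \<mu>\<^sub>1) * of_real t * V1_inv K t s \<mu>\<^sub>1 \<epsilon>\<^sub>1 \<mu>\<^sub>2 \<epsilon>\<^sub>2
        - (3 / 2 - \<mu>\<^sub>2) * of_real s * V2_inv K t s \<mu>\<^sub>1 \<epsilon>\<^sub>1 \<mu>\<^sub>2 \<epsilon>\<^sub>2
        + of_real s * of_real t / (\<mu>\<^sub>1 - \<mu>\<^sub>2)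
          * ((3 / 2 - \<mu>\<^sub>1) * d_s (V1_inv K) t s \<mu>\<^sub>1 \<epsilon>\<^sub>1 \<mu>\<^sub>2 \<epsilon>\<^sub>2
          + (3 / 2 - \<mu>\<^sub>2) * d_t (V2_inv K) t s \<mu>\<^sub>1 \<epsilon>\<^sub>1 \<mu>\<^sub>2 \<epsilon>\<^sub>2)) \<and>
    fourier_image_mero (entry_deriv 2 2)
      (\<lambda>K t s \<mu>\<^sub>1 \<epsilon>\<^sub>1 \<mu>\<^sub>2 \<epsilon>\<^sub>2.
        (3 / 2 - \<mu>\<^sub>2) * V2_inv K t s \<mu>\<^sub>1 \<epsilon>\<^sub>1 \<mu>\<^sub>2 \<epsilon>\<^sub>2
        - of_real t / (\<mu>\<^sub>1 - \<mu>\<^sub>2)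
          * ((3 / 2 - \<mu>\<^sub>1) * d_s (V1_inv K) t s \<mu>\<^sub>1 \<epsilon>\<^sub>1 \<mu>\<^sub>2 \<epsilon>\<^sub>2
          + (3 / 2 - \<mu>\<^sub>2) * d_t (V2_inv K) t s \<mu>\<^sub>1 \<epsilon>\<^sub>1 \<mu>\<^sub>2 \<epsilon>\<^sub>2))"
proof -
  note C1 = test_functions_C1c and C0 = C1c_GL2_dest(1)[OF test_functions_C1c]
  show ?thesis
    unfolding fourier_image_mero_def fourier_image_def
  proof (intro conjI ballI allI impI, goal_cases)
    case (1 F) then show ?case
      by (simp add: fourier_kernel_mult_entries[OF C0] fourier_kernel_mult_entry_21[OF C1])
  next
    case (2 F) then show ?case
      by (simp add: fourier_kernel_mult_entries[OF C0] fourier_kernel_mult_entry_21[OF C1])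
  next
    case (3 F) then show ?case
      by (simp add: fourier_kernel_mult_entry_21[OF C1])
  next
    case (4 F) then show ?case
      by (simp add: fourier_kernel_mult_entries[OF C0] fourier_kernel_mult_entry_21[OF C1])
  next
    case (5 F) then show ?case
      by (rule fourier_kernel_inverse_det[OF C0])
  next
    case (6 F) then show ?case
      by (simp add: entry_deriv_eq[OF C1] axis_mat2 fourier_kernel_derivatives[OF C1] fourier_kernel_derivative_12[OF C1])
  next
    case (7 F) then show ?case
      by (simp add: entry_deriv_eq[OF C1] axis_mat2 fourier_kernel_derivative_12[OF C1])
  next
    case (8 F) then show ?case
      by (simp add: entry_deriv_eq[OF C1] axis_mat2 fourier_kernel_derivatives[OF C1] fourier_kernel_derivative_12[OF C1])
  next
    case (9 F) then show ?case
      by (simp add: entry_deriv_eq[OF C1] axis_mat2 fourier_kernel_derivatives[OF C1] fourier_kernel_derivative_12[OF C1])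
  qed
qed

end
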